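(* For a finite simple chordal outerplanar graph $G$ with maximum degree $\Delta = 4$, we have $\omega(G^2) = \chi(G^2) = \mathrm{ind}(G^2) + 1 = 6$ if $F_4$ is a subgraph of $G$, and $\omega(G^2) = \chi(G^2) = \mathrm{ind}(G^2) + 1 = 5$ otherwise.
   Context: $G^2$ is the graph on $V(G)$ in which two distinct vertices are adjacent iff their distance in $G$ is 1 or 2; $\omega$ is the clique number, $\chi$ the chromatic number, and $\mathrm{ind}(H) = \max\{\delta(H') : H' \text{ an induced subgraph of } H\}$ the inductiveness. $F_4$ is the 6-vertex graph obtained from a triangle $K_3$ by adding, for each of its three edges, a new vertex adjacent to both endpoints of that edge. *)

theory Defs
  imports "HOL-Analysis.Analysis"
begin

text \<open>A graph is given by a vertex set \<open>V\<close> and an adjacency relation \<open>E\<close>.\<close>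

definition finite_simple_graph :: "'a set \<Rightarrow> ('a \<Rightarrow> 'a \<Rightarrow> bool) \<Rightarrow> bool" where
  "finite_simple_graph V E \<longleftrightarrow>
     finite V \<and> (\<forall>u v. E u v \<longrightarrow> u \<in> V \<and> v \<in> V \<and> u \<noteq> v \<and> E v u)"

definition vertex_degree :: "('a \<Rightarrow> 'a \<Rightarrow> bool) \<Rightarrow> 'a \<Rightarrow> nat" where
  "vertex_degree E v = card {u. E v u}"

text \<open>\<open>Sup\<close> on \<^typ>\<open>nat\<close> is the maximum of a finite nonempty set and \<open>0\<close> on the empty set, so the
  graph without vertices gets maximum degree \<open>0\<close> (and inductiveness \<open>0\<close> below).\<close>

definition max_degree :: "'a set \<Rightarrow> ('a \<Rightarrow> 'a \<Rightarrow> bool) \<Rightarrow> nat" where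
  "max_degree V E = (SUP v\<in>V. vertex_degree E v)"

definition min_degree :: "'a set \<Rightarrow> ('a \<Rightarrow> 'a \<Rightarrow> bool) \<Rightarrow> nat" where
  "min_degree V E = (INF v\<in>V. vertex_degree E v)"

definition induced_adj :: "'a set \<Rightarrow> ('a \<Rightarrow> 'a \<Rightarrow> bool) \<Rightarrow> 'a \<Rightarrow> 'a \<Rightarrow> bool" where
  "induced_adj W E u v \<longleftrightarrow> u \<in> W \<and> v \<in> W \<and> E u v"

definition inductiveness :: "'a set \<Rightarrow> ('a \<Rightarrow> 'a \<Rightarrow> bool) \<Rightarrow> nat" where
  "inductiveness V E = (SUP W\<in>{W. W \<subseteq> V \<and> W \<noteq> {}}. min_degree W (induced_adj W E))"

definition is_clique :: "'a set \<Rightarrow> ('a \<Rightarrow> 'a \<Rightarrow> bool) \<Rightarrow> 'a set \<Rightarrow> bool" where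
  "is_clique V E K \<longleftrightarrow> K \<subseteq> V \<and> (\<forall>u\<in>K. \<forall>v\<in>K. u \<noteq> v \<longrightarrow> E u v)"

definition clique_number :: "'a set \<Rightarrow> ('a \<Rightarrow> 'a \<Rightarrow> bool) \<Rightarrow> nat" where
  "clique_number V E = Max {card K | K. is_clique V E K}"

definition proper_coloring :: "'a set \<Rightarrow> ('a \<Rightarrow> 'a \<Rightarrow> bool) \<Rightarrow> ('a \<Rightarrow> nat) \<Rightarrow> bool" where
  "proper_coloring V E c \<longleftrightarrow> (\<forall>u\<in>V. \<forall>v\<in>V. E u v \<longrightarrow> c u \<noteq> c v)"

definition chromatic_number :: "'a set \<Rightarrow> ('a \<Rightarrow> 'a \<Rightarrow> bool) \<Rightarrow> nat" where
  "chromatic_number V E = (LEAST k. \<exists>c. proper_coloring V E c \<and> c ` V \<subseteq> {..<k})"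

text \<open>\<open>(E ^^ n) u v\<close> says that there is a walk of length \<open>n\<close> from \<open>u\<close> to \<open>v\<close>; the distance of
  vertices in different components is \<open>\<infinity>\<close>.\<close>

definition graph_dist :: "('a \<Rightarrow> 'a \<Rightarrow> bool) \<Rightarrow> 'a \<Rightarrow> 'a \<Rightarrow> enat" where
  "graph_dist E u v = (INF n\<in>{n. (E ^^ n) u v}. enat n)"

definition square_adj :: "('a \<Rightarrow> 'a \<Rightarrow> bool) \<Rightarrow> 'a \<Rightarrow> 'a \<Rightarrow> bool" where
  "square_adj E u v \<longleftrightarrow> u \<noteq> v \<and> (graph_dist E u v = 1 \<or> graph_dist E u v = 2)"

definition is_cycle :: "('a \<Rightarrow> 'a \<Rightarrow> bool) \<Rightarrow> 'a list \<Rightarrow> bool" where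
  "is_cycle E xs \<longleftrightarrow> 3 \<le> length xs \<and> distinct xs \<and>
     (\<forall>i. Suc i < length xs \<longrightarrow> E (xs ! i) (xs ! Suc i)) \<and> E (last xs) (hd xs)"

definition has_chord :: "('a \<Rightarrow> 'a \<Rightarrow> bool) \<Rightarrow> 'a list \<Rightarrow> bool" where
  "has_chord E xs \<longleftrightarrow>
     (\<exists>i j. Suc i < j \<and> j < length xs \<and> \<not> (i = 0 \<and> j = length xs - 1) \<and> E (xs ! i) (xs ! j))"

definition chordal :: "('a \<Rightarrow> 'a \<Rightarrow> bool) \<Rightarrow> bool" where
  "chordal E \<longleftrightarrow> (\<forall>xs. is_cycle E xs \<and> 4 \<le> length xs \<longrightarrow> has_chord E xs)"

text \<open>A plane drawing: \<open>p\<close> places the vertices and \<open>\<gamma> {u, v}\<close> is the arc drawn for the edge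
  \<open>{u, v}\<close>, traversed in either direction. Arcs meet vertices and one another only in the forced
  common endpoints.\<close>

definition plane_drawing ::
  "'a set \<Rightarrow> ('a \<Rightarrow> 'a \<Rightarrow> bool) \<Rightarrow> ('a \<Rightarrow> complex) \<Rightarrow> ('a set \<Rightarrow> real \<Rightarrow> complex) \<Rightarrow> bool" where
  "plane_drawing V E p \<gamma> \<longleftrightarrow>
     inj_on p V \<and>
     (\<forall>u v. E u v \<longrightarrow>
        arc (\<gamma> {u, v}) \<and>
        {pathstart (\<gamma> {u, v}), pathfinish (\<gamma> {u, v})} = {p u, p v} \<and>
        path_image (\<gamma> {u, v}) \<inter> p ` V = {p u, p v}) \<and>
     (\<forall>u v x y. E u v \<and> E x y \<and> {u, v} \<noteq> {x, y} \<longrightarrow>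
        path_image (\<gamma> {u, v}) \<inter> path_image (\<gamma> {x, y}) \<subseteq> p ` ({u, v} \<inter> {x, y}))"

definition drawing_image ::
  "'a set \<Rightarrow> ('a \<Rightarrow> 'a \<Rightarrow> bool) \<Rightarrow> ('a \<Rightarrow> complex) \<Rightarrow> ('a set \<Rightarrow> real \<Rightarrow> complex) \<Rightarrow> complex set" where
  "drawing_image V E p \<gamma> = p ` V \<union> \<Union> {path_image (\<gamma> {u, v}) | u v. E u v}"

text \<open>The drawing of a finite graph is compact, so \<^const>\<open>outside\<close> of it is the unique unbounded
  component of its complement, i.e. the outer face.\<close>

definition outerplanar :: "'a set \<Rightarrow> ('a \<Rightarrow> 'a \<Rightarrow> bool) \<Rightarrow> bool" where
  "outerplanar V E \<longleftrightarrow>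
     (\<exists>p \<gamma>. plane_drawing V E p \<gamma> \<and> p ` V \<subseteq> frontier (outside (drawing_image V E p \<gamma>)))"

text \<open>Subgraphs are not necessarily induced, and are taken up to isomorphism.\<close>

definition has_subgraph ::
  "'a set \<Rightarrow> ('a \<Rightarrow> 'a \<Rightarrow> bool) \<Rightarrow> 'b set \<Rightarrow> ('b \<Rightarrow> 'b \<Rightarrow> bool) \<Rightarrow> bool" where
  "has_subgraph V E W F \<longleftrightarrow>
     (\<exists>f. inj_on f W \<and> f ` W \<subseteq> V \<and> (\<forall>u\<in>W. \<forall>v\<in>W. F u v \<longrightarrow> E (f u) (f v)))"

text \<open>The triangle is on \<open>0, 1, 2\<close>; the vertices \<open>3, 4, 5\<close> are attached to its three edges.\<close>

definition F4_verts :: "nat set" where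
  "F4_verts = {0, 1, 2, 3, 4, 5}"

definition F4_adj :: "nat \<Rightarrow> nat \<Rightarrow> bool" where
  "F4_adj u v \<longleftrightarrow>
     {u, v} \<in> {{0, 1}, {1, 2}, {0, 2}, {3, 0}, {3, 1}, {4, 1}, {4, 2}, {5, 0}, {5, 2}}"

end

theory Submission
  imports Defs
begin

text \<open>Among three arcs with common endpoints one runs inside the closed curve formed by the other
  two (Janiszewski's theorem). Hence an outerplanar graph contains neither \<open>K\<^sub>4\<close> nor an edge in three
  triangles, and this is all that is used of the drawing.

  The square of a chordal graph stays the same on the remaining vertices when a simplicial vertex is
  deleted. So it suffices to find, in a nonempty chordal graph with maximum degree at most 4 and
  without these two configurations, a simplicial vertex with at most 4 neighbours in the square, or at
  most 5 if \<open>F\<^sub>4\<close> is present. A vertex of degree at most 1 will do. If there is none, choose a minimal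
  set \<open>C\<close> separated from the rest by one vertex \<open>c\<close> (an end block). An ear of it, i.e. a vertex \<open>w\<close>
  with exactly two neighbours \<open>a, b\<close>, which are adjacent, has at most the square neighbours \<open>a\<close>, \<open>b\<close>,
  the other common neighbour \<open>x\<close> of \<open>a\<close> and \<open>b\<close>, and one further neighbour of each of \<open>a\<close> and \<open>b\<close>.
  If \<open>a, b \<in> C\<close> and all five exist, they form a copy of \<open>F\<^sub>4\<close> together with \<open>w\<close>. If all ears touch
  \<open>c\<close>, five square neighbours would give an ear beyond the edge \<open>bx\<close>.

  The matching cliques of the square are the closed neighbourhood of a vertex of degree 4 and \<open>F\<^sub>4\<close>.\<close>

subsection \<open>Theta curves\<close>

definition arc_between :: "(real \<Rightarrow> complex) \<Rightarrow> complex \<Rightarrow> complex \<Rightarrow> bool" where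
  "arc_between g a b \<longleftrightarrow> arc g \<and> pathstart g = a \<and> pathfinish g = b"

lemma arc_between_join:
  assumes "arc_between g a b" "arc_between h b c" "path_image g \<inter> path_image h \<subseteq> {b}"
  shows "arc_between (g +++ h) a c" "path_image (g +++ h) = path_image g \<union> path_image h"
  using assms by (auto simp: arc_between_def path_image_join intro!: arc_join)

lemma arc_between_ends:
  assumes "arc_between g a b"
  shows "a \<in> path_image g" "b \<in> path_image g" "a \<noteq> b"
  using assms unfolding arc_between_def
  by (auto dest: arc_distinct_ends)

lemma two_arcs_Jordan:
  assumes "arc_between c1 a b" "arc_between c2 a b" "path_image c1 \<inter> path_image c2 = {a, b}"
  defines "C \<equiv> path_image c1 \<union> path_image c2"
  shows "connected (inside C)" "open (inside C)" "inside C \<noteq> {}" "frontier (inside C) = C"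
    "connected (outside C)" "compact C"
proof -
  let ?c = "c1 +++ reversepath c2"
  have im: "path_image ?c = C"
    using assms by (simp add: path_image_join arc_between_def)
  have "simple_path ?c" "pathfinish ?c = pathstart ?c"
    using assms by (auto simp: arc_between_def arc_reversepath intro!: simple_path_join_loop)
  from Jordan_inside_outside[OF this]
  show "connected (inside C)" "open (inside C)" "inside C \<noteq> {}" "frontier (inside C) = C"
    "connected (outside C)"
    unfolding im by auto
  show "compact C"
    using assms by (simp add: arc_between_def compact_arc_image compact_Un)
qed

text \<open>Without its ends the arc is still connected, so it could enter the inside only across
  the frontier \<open>C\<close>, which it meets at most in \<open>a\<close> and \<open>b\<close>.
  One point \<open>w\<close> off the inside decides for the whole arc.\<close>

lemma endless_arc_avoids_inside:
  assumes "arc_between c a b" "w \<in> path_image c - {a, b}" "w \<notin> inside C"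
    and "frontier (inside C) = C" "path_image c \<inter> C \<subseteq> {a, b}" "a \<in> C" "b \<in> C"
  shows "path_image c \<inter> inside C = {}"
proof (rule ccontr)
  let ?S = "path_image c - {a, b}"
  assume "path_image c \<inter> inside C \<noteq> {}"
  then have "?S \<inter> inside C \<noteq> {}"
    using assms(6,7) inside_no_overlap[of C] by blast
  moreover have "connected ?S"
    using assms(1) connected_simple_path_endless[of c] arc_imp_simple_path
    by (auto simp: arc_between_def)
  moreover have "?S - inside C \<noteq> {}"
    using assms by auto
  ultimately have "?S \<inter> frontier (inside C) \<noteq> {}"
    by (intro connected_Int_frontier)
  then show False
    using assms by auto
qed

text \<open>The inside of the curve \<open>c1\<close>, \<open>c2\<close> is connected and misses
  \<open>c1\<close> and \<open>c3\<close>, so if the two insides met, it would be contained in the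
  other one. Its boundary point \<open>w2\<close> would then lie in the closure of the other one,
  hence inside or on the curve \<open>c1\<close>, \<open>c3\<close>.\<close>

lemma insides_disjoint:
  assumes "arc_between c1 a b" "arc_between c2 a b" "arc_between c3 a b"
    and i12: "path_image c1 \<inter> path_image c2 = {a, b}"
    and i13: "path_image c1 \<inter> path_image c3 = {a, b}"
    and i23: "path_image c2 \<inter> path_image c3 = {a, b}"
    and w2: "w2 \<in> path_image c2 - {a, b}" "w2 \<notin> inside (path_image c1 \<union> path_image c3)"
    and w3: "w3 \<in> path_image c3 - {a, b}" "w3 \<notin> inside (path_image c1 \<union> path_image c2)"
  shows "inside (path_image c1 \<union> path_image c2) \<inter> inside (path_image c1 \<union> path_image c3) = {}"
proof (rule ccontr)
  let ?C12 = "path_image c1 \<union> path_image c2" and ?C13 = "path_image c1 \<union> path_image c3"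
  assume ne: "inside ?C12 \<inter> inside ?C13 \<noteq> {}"
  note J12 = two_arcs_Jordan[OF assms(1,2) i12] and J13 = two_arcs_Jordan[OF assms(1,3) i13]
  have "path_image c3 \<inter> inside ?C12 = {}"
    using arc_between_ends[OF assms(1)] i13 i23
    by (intro endless_arc_avoids_inside[OF assms(3) w3 J12(4)]) auto
  then have "inside ?C12 \<inter> ?C13 = {}"
    using inside_no_overlap[of ?C12] by blast
  then have "inside ?C12 \<subseteq> inside ?C13"
    using connected_Int_frontier[OF J12(1) ne] unfolding J13(4) by blast
  then have "closure (inside ?C12) \<subseteq> closure (inside ?C13)"
    by (rule closure_mono)
  moreover have "w2 \<in> frontier (inside ?C12)"
    unfolding J12(4) using w2 by auto
  ultimately have "w2 \<in> closure (inside ?C13)"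
    by (auto simp: frontier_def)
  then have "w2 \<in> inside ?C13 \<union> ?C13"
    unfolding closure_Un_frontier J13(4) .
  then show False
    using w2 i12 i23 by auto
qed

text \<open>If no arc runs in the middle, a point inside the curve \<open>c1\<close>,
  \<open>c2\<close> lies outside the other two closed curves. These meet exactly in the connected
  set \<open>c3\<close>, so Janiszewski's theorem joins the point to an outer point off their union,
  in particular off \<open>c1\<close> and \<open>c2\<close>.\<close>

theorem theta_curve_middle_arc:
  assumes "arc_between c1 a b" "arc_between c2 a b" "arc_between c3 a b"
    and i12: "path_image c1 \<inter> path_image c2 = {a, b}"
    and i13: "path_image c1 \<inter> path_image c3 = {a, b}"
    and i23: "path_image c2 \<inter> path_image c3 = {a, b}"
    and w: "w1 \<in> path_image c1 - {a, b}" "w2 \<in> path_image c2 - {a, b}" "w3 \<in> path_image c3 - {a, b}"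
  shows "w1 \<in> inside (path_image c2 \<union> path_image c3) \<or>
    w2 \<in> inside (path_image c1 \<union> path_image c3) \<or>
    w3 \<in> inside (path_image c1 \<union> path_image c2)"
proof (rule ccontr)
  let ?C12 = "path_image c1 \<union> path_image c2" and ?C13 = "path_image c1 \<union> path_image c3"
    and ?C23 = "path_image c2 \<union> path_image c3"
  assume "\<not> ?thesis"
  then have n: "w1 \<notin> inside ?C23" "w2 \<notin> inside ?C13" "w3 \<notin> inside ?C12"
    by auto
  note J12 = two_arcs_Jordan[OF assms(1,2) i12] and J13 = two_arcs_Jordan[OF assms(1,3) i13]
    and J23 = two_arcs_Jordan[OF assms(2,3) i23]
  have d13: "inside ?C12 \<inter> inside ?C13 = {}"
    by (rule insides_disjoint[OF assms(1-3) i12 i13 i23 w(2) n(2) w(3) n(3)])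
  have d23: "inside ?C12 \<inter> inside ?C23 = {}"
    using insides_disjoint[OF assms(2,1,3) _ i23 i13 w(1) n(1) w(3)] n(3) i12
    by (simp add: Un_commute Int_commute)
  have d3: "path_image c3 \<inter> inside ?C12 = {}"
    using arc_between_ends[OF assms(1)] i13 i23
    by (intro endless_arc_avoids_inside[OF assms(3) w(3) n(3) J12(4)]) auto
  obtain x where x: "x \<in> inside ?C12"
    using J12(3) by auto
  then have "x \<notin> ?C12"
    using inside_no_overlap[of ?C12] by blast
  with x d3 d13 d23 have x': "x \<in> outside ?C13" "x \<in> outside ?C23"
    using inside_Un_outside[of ?C13] inside_Un_outside[of ?C23] by blast+
  have "bounded (?C13 \<union> ?C23)"
    using compact_imp_bounded[OF compact_Un[OF J13(6) J23(6)]] .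
  then have "outside (?C13 \<union> ?C23) \<noteq> {}"
    by (metis bounded_empty unbounded_outside)
  then obtain y where y: "y \<in> outside (?C13 \<union> ?C23)"
    by auto
  then have y': "y \<in> outside ?C13" "y \<in> outside ?C23" "y \<in> outside ?C12"
    using outside_mono[of ?C13 "?C13 \<union> ?C23"] outside_mono[of ?C23 "?C13 \<union> ?C23"]
      outside_mono[of ?C12 "?C13 \<union> ?C23"] by auto
  have cc: "connected_component (- ?C13) x y" "connected_component (- ?C23) x y"
    unfolding connected_component_def
    using x' y' J13(5) J23(5) outside_no_overlap[of ?C13] outside_no_overlap[of ?C23]
    by blast+
  have "?C13 \<inter> ?C23 = path_image c3"
    using i12 arc_between_ends[OF assms(3)] by auto
  then have "connected (?C13 \<inter> ?C23)"
    using assms(3) by (simp add: arc_between_def connected_arc_image)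
  then have "connected_component (- (?C13 \<union> ?C23)) x y"
    by (rule Janiszewski_weak[OF J13(6) J23(6) _ cc])
  then have "connected_component (- ?C12) x y"
    by (rule connected_component_of_subset) auto
  then have "y \<in> inside ?C12"
    using x inside_same_component by blast
  then show False
    using y'(3) inside_Int_outside by blast
qed

text \<open>The inside of \<open>C\<close> is open and disjoint from \<open>outside D\<close>, hence
  also from its closure. This keeps vertices on the outer face out of every closed curve made of
  edges.\<close>

lemma frontier_outside_not_inside:
  fixes C D :: "complex set"
  assumes "z \<in> frontier (outside D)" "C \<subseteq> D" "closed C"
  shows "z \<notin> inside C"
proof -
  have "inside C \<inter> outside D = {}"
    using outside_mono[OF assms(2)] inside_Int_outside[of C] by blast
  then have "inside C \<inter> closure (outside D) = {}"
    using open_Int_closure_eq_empty[OF open_inside[OF assms(3)]] by auto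
  then show ?thesis
    using assms(1) by (auto simp: frontier_def)
qed

text \<open>The crossing argument of \<open>endless_arc_avoids_inside\<close> with only one end on
  \<open>C\<close>: the connected set is now the image of the half-open interval.\<close>

lemma half_open_arc_avoids_inside:
  assumes "arc_between g a b" "b \<notin> inside C" "path_image g \<inter> C \<subseteq> {a}" "a \<in> C"
    "frontier (inside C) = C"
  shows "path_image g \<inter> inside C = {}"
proof (rule ccontr)
  let ?S = "path_image g - {a}"
  assume "path_image g \<inter> inside C \<noteq> {}"
  then have "?S \<inter> inside C \<noteq> {}"
    using assms(4) inside_no_overlap[of C] by blast
  moreover have "?S = g ` {0<..1}"
  proof -
    have inj: "inj_on g {0..1}" and g0: "g 0 = a"
      using assms(1) by (auto simp: arc_between_def arc_def pathstart_def)
    have "g t \<noteq> a" if "t \<in> {0<..1}" for t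
      using inj_onD[OF inj, of t 0] that g0 by auto
    moreover have "{0..1} = insert (0::real) {0<..1}"
      by auto
    ultimately show ?thesis
      using g0 unfolding path_image_def by auto
  qed
  moreover have "continuous_on {0<..1} g"
    using assms(1) by (auto simp: arc_between_def arc_def path_def intro: continuous_on_subset)
  ultimately have "connected ?S"
    by (simp add: connected_continuous_image)
  moreover have "?S - inside C \<noteq> {}"
    using assms(2) arc_between_ends[OF assms(1)] by auto
  ultimately have "?S \<inter> frontier (inside C) \<noteq> {}"
    using \<open>?S \<inter> inside C \<noteq> {}\<close> by (intro connected_Int_frontier)
  then show False
    using assms(3,5) by auto
qed

lemma arc_between_interior_point:
  assumes "arc_between g a b"
  obtains z where "z \<in> path_image g - {a, b}"
proof -
  have inj: "inj_on g {0..1}" and ends: "g 0 = a" "g 1 = b"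
    using assms by (auto simp: arc_between_def arc_def pathstart_def pathfinish_def)
  have "g (1/2) \<noteq> a" "g (1/2) \<noteq> b"
    using inj_onD[OF inj, of "1/2" 0] inj_onD[OF inj, of "1/2" 1] ends by auto
  moreover have "g (1/2) \<in> path_image g"
    by (auto simp: path_image_def)
  ultimately show ?thesis
    using that by blast
qed

subsection \<open>Outerplanar drawings\<close>

locale outerplane_graph =
  fixes V :: "'a set" and E :: "'a \<Rightarrow> 'a \<Rightarrow> bool"
    and p :: "'a \<Rightarrow> complex" and \<gamma> :: "'a set \<Rightarrow> real \<Rightarrow> complex"
  assumes simple: "finite_simple_graph V E"
    and drawing: "plane_drawing V E p \<gamma>"
    and outer: "p ` V \<subseteq> frontier (outside (drawing_image V E p \<gamma>))"
begin

abbreviation im :: "'a \<Rightarrow> 'a \<Rightarrow> complex set" where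
  "im u v \<equiv> path_image (\<gamma> {u, v})"

lemma edge_verts:
  assumes "E u v"
  shows "u \<in> V" "v \<in> V" "u \<noteq> v" "E v u"
  using simple assms by (auto simp: finite_simple_graph_def)

lemma p_eq_iff: "u \<in> V \<Longrightarrow> v \<in> V \<Longrightarrow> p u = p v \<longleftrightarrow> u = v"
  using drawing by (auto simp: plane_drawing_def dest: inj_onD)

lemma im_commute: "im u v = im v u"
  by (simp add: insert_commute)

lemma im_verts:
  assumes "E u v" "w \<in> V"
  shows "p w \<in> im u v \<longleftrightarrow> w = u \<or> w = v"
proof -
  have "im u v \<inter> p ` V = {p u, p v}"
    using drawing assms(1) by (auto simp: plane_drawing_def)
  then show ?thesis
    using assms edge_verts[OF assms(1)] p_eq_iff by blast
qed

lemma im_Int: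
  assumes "E u v" "E x y" "{u, v} \<noteq> {x, y}"
  shows "im u v \<inter> im x y \<subseteq> p ` ({u, v} \<inter> {x, y})"
  using drawing assms unfolding plane_drawing_def by blast

lemma im_subset: "E u v \<Longrightarrow> im u v \<subseteq> drawing_image V E p \<gamma>"
  by (auto simp: drawing_image_def)

lemma vertex_not_inside:
  assumes "w \<in> V" "C \<subseteq> drawing_image V E p \<gamma>" "compact C"
  shows "p w \<notin> inside C"
  using frontier_outside_not_inside[OF _ assms(2)] outer assms by (auto simp: compact_imp_closed)

lemma edge_arc:
  assumes "E u v"
  obtains g where "arc_between g (p u) (p v)" "path_image g = im u v"
proof -
  have a: "arc (\<gamma> {u, v})" and "{pathstart (\<gamma> {u, v}), pathfinish (\<gamma> {u, v})} = {p u, p v}"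
    using drawing assms by (auto simp: plane_drawing_def)
  then consider "pathstart (\<gamma> {u, v}) = p u" "pathfinish (\<gamma> {u, v}) = p v"
    | "pathstart (\<gamma> {u, v}) = p v" "pathfinish (\<gamma> {u, v}) = p u"
    by (auto simp: doubleton_eq_iff)
  then show ?thesis
  proof cases
    case 1
    then show ?thesis
      using that[of "\<gamma> {u, v}"] a by (auto simp: arc_between_def)
  next
    case 2
    then show ?thesis
      using that[of "reversepath (\<gamma> {u, v})"] a by (auto simp: arc_between_def arc_reversepath)
  qed
qed

lemma two_edge_arc:
  assumes "E u w" "E w v" "u \<noteq> v"
  obtains g where "arc_between g (p u) (p v)" "path_image g = im u w \<union> im w v"
proof -
  obtain g h where g: "arc_between g (p u) (p w)" "path_image g = im u w"
    and h: "arc_between h (p w) (p v)" "path_image h = im w v"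
    using edge_arc assms by metis
  have "{u, w} \<noteq> {w, v}" "{u, w} \<inter> {w, v} = {w}"
    using assms edge_verts by (auto simp: doubleton_eq_iff)
  then have "path_image g \<inter> path_image h \<subseteq> {p w}"
    using im_Int[OF assms(1,2)] g h by auto
  then show ?thesis
    using that arc_between_join[OF g(1) h(1)] g h by metis
qed

lemma two_edge_arcs_Int:
  assumes "E u w" "E w v" "E u w'" "E w' v" "u \<noteq> v" "w \<noteq> w'"
  shows "(im u w \<union> im w v) \<inter> (im u w' \<union> im w' v) = {p u, p v}"
proof
  have ne: "u \<noteq> w" "u \<noteq> w'" "v \<noteq> w" "v \<noteq> w'"
    using assms edge_verts by blast+
  have "im u w \<inter> im u w' \<subseteq> {p u}" "im u w \<inter> im w' v \<subseteq> {}"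
    "im w v \<inter> im u w' \<subseteq> {}" "im w v \<inter> im w' v \<subseteq> {p v}"
    using im_Int[of u w u w'] im_Int[of u w w' v] im_Int[of w v u w'] im_Int[of w v w' v] assms ne
    by (auto simp: doubleton_eq_iff)
  then show "(im u w \<union> im w v) \<inter> (im u w' \<union> im w' v) \<subseteq> {p u, p v}"
    by blast
  show "{p u, p v} \<subseteq> (im u w \<union> im w v) \<inter> (im u w' \<union> im w' v)"
    using im_verts assms edge_verts by auto
qed

lemma two_edge_arc_Int_edge:
  assumes "E u w" "E w v" "E u v"
  shows "(im u w \<union> im w v) \<inter> im u v = {p u, p v}"
proof
  have ne: "u \<noteq> w" "u \<noteq> v" "v \<noteq> w"
    using assms edge_verts by blast+
  have "im u w \<inter> im u v \<subseteq> {p u}" "im w v \<inter> im u v \<subseteq> {p v}"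
    using im_Int[of u w u v] im_Int[of w v u v] assms ne
    by (auto simp: doubleton_eq_iff)
  then show "(im u w \<union> im w v) \<inter> im u v \<subseteq> {p u, p v}"
    by blast
  show "{p u, p v} \<subseteq> (im u w \<union> im w v) \<inter> im u v"
    using im_verts assms edge_verts by auto
qed

text \<open>The three paths of length two form a theta curve, which would put one of
  \<open>x\<close>, \<open>y\<close>, \<open>z\<close> inside the cycle through the other two, away
  from the outer face.\<close>

theorem no_K23:
  assumes "u \<noteq> v" "x \<noteq> y" "x \<noteq> z" "y \<noteq> z"
    and x: "E u x" "E x v" and y: "E u y" "E y v" and z: "E u z" "E z v"
  shows False
proof -
  obtain f where f: "arc_between f (p u) (p v)" "path_image f = im u x \<union> im x v"
    using two_edge_arc[OF x \<open>u \<noteq> v\<close>] .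
  obtain g where g: "arc_between g (p u) (p v)" "path_image g = im u y \<union> im y v"
    using two_edge_arc[OF y \<open>u \<noteq> v\<close>] .
  obtain h where h: "arc_between h (p u) (p v)" "path_image h = im u z \<union> im z v"
    using two_edge_arc[OF z \<open>u \<noteq> v\<close>] .
  have fg: "path_image f \<inter> path_image g = {p u, p v}"
    unfolding f g by (rule two_edge_arcs_Int[OF x y \<open>u \<noteq> v\<close> \<open>x \<noteq> y\<close>])
  have fh: "path_image f \<inter> path_image h = {p u, p v}"
    unfolding f h by (rule two_edge_arcs_Int[OF x z \<open>u \<noteq> v\<close> \<open>x \<noteq> z\<close>])
  have gh: "path_image g \<inter> path_image h = {p u, p v}"
    unfolding g h by (rule two_edge_arcs_Int[OF y z \<open>u \<noteq> v\<close> \<open>y \<noteq> z\<close>])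
  have mid: "p x \<in> path_image f - {p u, p v}" "p y \<in> path_image g - {p u, p v}"
    "p z \<in> path_image h - {p u, p v}"
    unfolding f(2) g(2) h(2) using x y z im_verts p_eq_iff edge_verts by auto
  have sub: "path_image f \<subseteq> drawing_image V E p \<gamma>" "path_image g \<subseteq> drawing_image V E p \<gamma>"
    "path_image h \<subseteq> drawing_image V E p \<gamma>"
    unfolding f(2) g(2) h(2) using im_subset x y z by auto
  have "p x \<notin> inside (path_image g \<union> path_image h)"
    "p y \<notin> inside (path_image f \<union> path_image h)"
    "p z \<notin> inside (path_image f \<union> path_image g)"
    using vertex_not_inside[OF _ _ two_arcs_Jordan(6)[OF f(1) g(1) fg]]
      vertex_not_inside[OF _ _ two_arcs_Jordan(6)[OF f(1) h(1) fh]]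
      vertex_not_inside[OF _ _ two_arcs_Jordan(6)[OF g(1) h(1) gh]] sub edge_verts x y z
    by (meson Un_least)+
  then show False
    using theta_curve_middle_arc[OF f(1) g(1) h(1) fg fh gh mid] by blast
qed

text \<open>The edge \<open>uv\<close> is the middle arc of the theta curve that it forms with the paths through
  \<open>x\<close> and \<open>y\<close>, because these two vertices lie on the outer face.\<close>

lemma chord_of_4_cycle_inside:
  assumes "x \<noteq> y" and uv: "E u v" and x: "E u x" "E x v" and y: "E u y" "E y v"
  obtains z where "z \<in> im u v - {p u, p v}" "z \<in> inside ((im u x \<union> im x v) \<union> (im u y \<union> im y v))"
proof -
  have "u \<noteq> v"
    using edge_verts uv by auto
  obtain f where f: "arc_between f (p u) (p v)" "path_image f = im u x \<union> im x v"
    using two_edge_arc[OF x \<open>u \<noteq> v\<close>] .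
  obtain g where g: "arc_between g (p u) (p v)" "path_image g = im u y \<union> im y v"
    using two_edge_arc[OF y \<open>u \<noteq> v\<close>] .
  obtain h where h: "arc_between h (p u) (p v)" "path_image h = im u v"
    using edge_arc[OF uv] .
  have fg: "path_image f \<inter> path_image g = {p u, p v}"
    unfolding f g by (rule two_edge_arcs_Int[OF x y \<open>u \<noteq> v\<close> \<open>x \<noteq> y\<close>])
  have fh: "path_image f \<inter> path_image h = {p u, p v}"
    unfolding f h by (rule two_edge_arc_Int_edge[OF x uv])
  have gh: "path_image g \<inter> path_image h = {p u, p v}"
    unfolding g h by (rule two_edge_arc_Int_edge[OF y uv])
  obtain z where z: "z \<in> path_image h - {p u, p v}"
    using arc_between_interior_point[OF h(1)] .
  have mid: "p x \<in> path_image f - {p u, p v}" "p y \<in> path_image g - {p u, p v}"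
    unfolding f(2) g(2) using x y im_verts p_eq_iff edge_verts by auto
  have sub: "path_image f \<subseteq> drawing_image V E p \<gamma>" "path_image g \<subseteq> drawing_image V E p \<gamma>"
    "path_image h \<subseteq> drawing_image V E p \<gamma>"
    unfolding f(2) g(2) h(2) using im_subset x y uv by auto
  have "p x \<notin> inside (path_image g \<union> path_image h)"
    "p y \<notin> inside (path_image f \<union> path_image h)"
    using vertex_not_inside[OF _ _ two_arcs_Jordan(6)[OF f(1) h(1) fh]]
      vertex_not_inside[OF _ _ two_arcs_Jordan(6)[OF g(1) h(1) gh]] sub edge_verts x y
    by (meson Un_least)+
  then have "z \<in> inside (path_image f \<union> path_image g)"
    using theta_curve_middle_arc[OF f(1) g(1) h(1) fg fh gh mid z] by blast
  then show ?thesis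
    using that z unfolding f(2) g(2) h(2) by blast
qed

text \<open>The edge leaves the triangle at \<open>x\<close>, does not meet it again and ends in the
  vertex \<open>y\<close>, which is not inside.\<close>

lemma edge_avoids_inside_triangle:
  assumes "E u v" "E u x" "E x v" "E x y" "y \<noteq> u" "y \<noteq> v"
  shows "im x y \<inter> inside ((im u x \<union> im x v) \<union> im u v) = {}"
proof -
  let ?C = "(im u x \<union> im x v) \<union> im u v"
  have "u \<noteq> v"
    using edge_verts assms by auto
  obtain f where f: "arc_between f (p u) (p v)" "path_image f = im u x \<union> im x v"
    using two_edge_arc[OF assms(2,3) \<open>u \<noteq> v\<close>] .
  obtain h where h: "arc_between h (p u) (p v)" "path_image h = im u v"
    using edge_arc[OF assms(1)] .
  obtain g where g: "arc_between g (p x) (p y)" "path_image g = im x y"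
    using edge_arc[OF assms(4)] .
  have fh: "path_image f \<inter> path_image h = {p u, p v}"
    unfolding f h by (rule two_edge_arc_Int_edge[OF assms(2,3,1)])
  note J = two_arcs_Jordan[OF f(1) h(1) fh, unfolded f(2) h(2)]
  have ne: "x \<noteq> u" "x \<noteq> v" "x \<noteq> y"
    using edge_verts assms by blast+
  have "im x y \<inter> im u x \<subseteq> {p x}" "im x y \<inter> im x v \<subseteq> {p x}" "im x y \<inter> im u v \<subseteq> {}"
    using im_Int[of x y u x] im_Int[of x y x v] im_Int[of x y u v] assms ne \<open>u \<noteq> v\<close>
    by (auto simp: doubleton_eq_iff)
  then have "path_image g \<inter> ?C \<subseteq> {p x}"
    unfolding g by blast
  moreover have "p y \<notin> inside ?C"
    using assms edge_verts im_subset J(6) by (intro vertex_not_inside) auto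
  moreover have "p x \<in> ?C"
    using im_verts assms edge_verts by auto
  ultimately have "path_image g \<inter> inside ?C = {}"
    using half_open_arc_avoids_inside[OF g(1)] J(4) by blast
  then show ?thesis
    unfolding g(2) .
qed

text \<open>Both chords \<open>uv\<close> and \<open>xy\<close> of the 4-cycle
  \<open>u x v y\<close> run inside it. The chord \<open>uv\<close> splits this inside into those of
  two triangles, but \<open>xy\<close> enters neither of them and does not meet
  \<open>uv\<close>.\<close>

theorem no_K4:
  assumes uv: "E u v" and x: "E u x" "E x v" and y: "E u y" "E y v" and xy: "E x y"
  shows False
proof -
  have ne: "u \<noteq> v" "x \<noteq> y" "x \<noteq> u" "x \<noteq> v" "y \<noteq> u" "y \<noteq> v"
    using assms edge_verts by blast+
  let ?X = "im u x \<union> im x v" and ?Y = "im u y \<union> im y v"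
  obtain z where z: "z \<in> im u v - {p u, p v}" "z \<in> inside (?X \<union> ?Y)"
    using chord_of_4_cycle_inside[OF \<open>x \<noteq> y\<close> uv x y] .
  \<comment> \<open>The same 4-cycle, read with the roles of the two diagonals exchanged.\<close>
  have "(im x u \<union> im u y) \<union> (im x v \<union> im v y) = ?X \<union> ?Y"
    using im_commute by blast
  then obtain z' where z': "z' \<in> im x y - {p x, p y}" "z' \<in> inside (?X \<union> ?Y)"
    using chord_of_4_cycle_inside[OF \<open>u \<noteq> v\<close> xy] assms edge_verts by metis
  obtain f where f: "arc_between f (p u) (p v)" "path_image f = ?X"
    using two_edge_arc[OF x \<open>u \<noteq> v\<close>] .
  obtain g where g: "arc_between g (p u) (p v)" "path_image g = ?Y"
    using two_edge_arc[OF y \<open>u \<noteq> v\<close>] .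
  obtain h where h: "arc_between h (p u) (p v)" "path_image h = im u v"
    using edge_arc[OF uv] .
  have fg: "path_image f \<inter> path_image g = {p u, p v}"
    unfolding f g by (rule two_edge_arcs_Int[OF x y \<open>u \<noteq> v\<close> \<open>x \<noteq> y\<close>])
  have fh: "path_image f \<inter> path_image h = {p u, p v}"
    unfolding f h by (rule two_edge_arc_Int_edge[OF x uv])
  have gh: "path_image g \<inter> path_image h = {p u, p v}"
    unfolding g h by (rule two_edge_arc_Int_edge[OF y uv])
  have "path_image h \<inter> inside (path_image f \<union> path_image g) \<noteq> {}"
    unfolding f g h using z by blast
  note split = split_inside_simple_closed_curve[OF _ _ _ _ _ _ _ _ _ _ fg fh gh this]
  have "inside (path_image f \<union> path_image h) \<union> inside (path_image g \<union> path_image h) \<union>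
    (path_image h - {p u, p v}) = inside (path_image f \<union> path_image g)"
    by (rule split) (use f(1) g(1) h(1) arc_between_ends(3)[OF h(1)] in
        \<open>simp_all add: arc_between_def arc_imp_simple_path\<close>)
  then have "z' \<in> inside (?X \<union> im u v) \<union> inside (?Y \<union> im u v) \<union> im u v"
    unfolding f(2) g(2) h(2) using z' by blast
  moreover have "im x y \<inter> im u v = {}"
    using im_Int[OF xy uv] ne by (auto simp: doubleton_eq_iff)
  moreover have "im x y \<inter> inside (?X \<union> im u v) = {}"
    by (rule edge_avoids_inside_triangle[OF uv x xy ne(5,6)])
  moreover have "im y x \<inter> inside (?Y \<union> im u v) = {}"
    using edge_verts xy by (intro edge_avoids_inside_triangle[OF uv y _ ne(3,4)]) auto
  ultimately show False
    using z'(1) im_commute[of x y] by blast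
qed

end

subsection \<open>Squares and links in chordal graphs\<close>

text \<open>The infimum defining the distance is below \<open>m\<close> iff some walk is shorter
  than \<open>m\<close>, and it is \<open>0\<close> only for \<open>u = v\<close>. For distinct
  vertices, adjacency in the square thus becomes distance below 3.\<close>

lemma square_adj_iff: "square_adj E u v \<longleftrightarrow> u \<noteq> v \<and> (E u v \<or> (\<exists>x. E u x \<and> E x v))"
proof (cases "u = v")
  case False
  let ?d = "graph_dist E u v"
  have less: "?d < enat m \<longleftrightarrow> (\<exists>n<m. (E ^^ n) u v)" for m
    unfolding graph_dist_def by (auto simp: INF_less_iff)
  have "?d \<noteq> 0"
    using less[of 1] False by (auto simp: zero_enat_def)
  then have "square_adj E u v \<longleftrightarrow> ?d < enat 3"
    using False by (cases ?d) (auto simp: square_adj_def zero_enat_def one_enat_def numeral_eq_enat)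
  also have "\<dots> \<longleftrightarrow> E u v \<or> (\<exists>x. E u x \<and> E x v)"
    unfolding less using False
    by (simp add: numeral_3_eq_3 less_Suc_eq conj_disj_distribR ex_disj_distrib OO_def eq_commute)
  finally show ?thesis
    using False by simp
qed (simp add: square_adj_def)

lemma rtranclp_leaves:
  assumes "R\<^sup>*\<^sup>* x y" "x \<in> S" "y \<notin> S"
  obtains p q where "R p q" "p \<in> S" "q \<notin> S"
  using assms by (induction rule: rtranclp_induct) auto

text \<open>Being reflexive also at vertices outside \<open>K\<close>, this needs
  \<open>x \<in> K\<close> as a separate assumption wherever the whole walk has to lie in
  \<open>K\<close>.\<close>

abbreviation reach_in :: "('a \<Rightarrow> 'a \<Rightarrow> bool) \<Rightarrow> 'a set \<Rightarrow> 'a \<Rightarrow> 'a \<Rightarrow> bool" where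
  "reach_in E K \<equiv> (induced_adj K E)\<^sup>*\<^sup>*"

lemma reach_in_mono:
  assumes "reach_in E K x y" "K \<subseteq> L"
  shows "reach_in E L x y"
  using assms(1) by (rule rtranclp_mono[THEN predicate2D, rotated])
    (use assms(2) in \<open>auto simp: induced_adj_def\<close>)

lemma reach_in_walk:
  assumes "reach_in E K x y" "x \<in> K"
  obtains ps where "ps \<noteq> []" "hd ps = x" "last ps = y" "set ps \<subseteq> K" "successively E ps"
proof -
  have "\<exists>ps. ps \<noteq> [] \<and> hd ps = x \<and> last ps = y \<and> set ps \<subseteq> K \<and> successively E ps"
    using assms
  proof (induction rule: rtranclp_induct)
    case base
    then show ?case
      by (intro exI[of _ "[x]"]) auto
  next
    case (step y z)
    then obtain ps where ps: "ps \<noteq> []" "hd ps = x" "last ps = y" "set ps \<subseteq> K" "successively E ps"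
      by blast
    with step.hyps show ?case
      by (intro exI[of _ "ps @ [z]"]) (auto simp: successively_append_iff induced_adj_def)
  qed
  then show ?thesis
    using that by blast
qed

text \<open>A shortest walk joining two neighbours of \<open>d\<close> closes up with \<open>d\<close> to a cycle, whose chords
  can only shorten the walk or join \<open>d\<close> to it.\<close>

lemma chordal_link_walk:
  assumes "chordal E" "d \<notin> K"
    and "ps \<noteq> []" "set ps \<subseteq> K" "successively E ps" "E d (hd ps)" "E d (last ps)"
    and sym: "\<And>x y. E x y \<Longrightarrow> E y x"
  shows "reach_in E (K \<inter> {v. E d v}) (hd ps) (last ps)"
  using assms(3-7)
proof (induction ps rule: length_induct)
  case (1 ps)
  let ?n = "length ps" and ?goal = "reach_in E (K \<inter> {v. E d v}) (hd ps) (last ps)"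
  have IH: "reach_in E (K \<inter> {v. E d v}) (hd qs) (last qs)"
    if "length qs < ?n" "qs \<noteq> []" "set qs \<subseteq> set ps" "successively E qs" "E d (hd qs)" "E d (last qs)"
    for qs
    using 1(1)[rule_format, of qs] 1(3) that by auto
  note ps = 1(2-6)
  \<comment> \<open>Skipping the entries from \<open>i\<close> to \<open>j - 1\<close> gives a
    shorter walk with the same ends. This serves for repeated vertices as well as for chords within
    the walk.\<close>
  have short: ?case
    if "j < ?n" "length (take i ps) < j" "i > 0 \<Longrightarrow> E (ps ! (i - 1)) (ps ! j)"
      "i = 0 \<Longrightarrow> ps ! j = hd ps" for i j
  proof -
    let ?qs = "take i ps @ drop j ps"
    have ij: "i < j"
      using that(1,2) by auto
    have ne: "drop j ps \<noteq> []"
      using that(1) by simp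
    have s: "successively E (take i ps)" "successively E (drop j ps)"
      using ps(3) by (metis append_take_drop_id successively_append_iff)+
    have "last (take i ps) = ps ! (i - 1)" if "i > 0"
      using that ij \<open>j < ?n\<close> by (cases i) (auto simp: take_Suc_conv_app_nth)
    then have "successively E ?qs"
      using s that ij by (auto simp: successively_append_iff hd_drop_conv_nth)
    moreover have h: "hd ?qs = hd ps"
      using that ij ps(1) by (cases "i = 0") (auto simp: hd_drop_conv_nth hd_append)
    moreover have l: "last ?qs = last ps"
      using ne that(1) by (simp add: last_drop)
    moreover have "set ?qs \<subseteq> set ps"
      using set_take_subset set_drop_subset by fastforce
    moreover have "length ?qs < ?n"
      using ij that(1) by auto
    ultimately show ?case
      using IH[of ?qs] ne ps by auto
  qed
  \<comment> \<open>An inner vertex of the walk adjacent to \<open>d\<close> splits it into two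
    shorter walks between neighbours of \<open>d\<close>.\<close>
  have split: ?case if "0 < i" "Suc i < ?n" "E d (ps ! i)" for i
  proof -
    have s: "successively E (take (Suc i) ps)" "successively E (drop i ps)"
      using ps(3) by (metis append_take_drop_id successively_append_iff)+
    have l: "last (take (Suc i) ps) = ps ! i" "hd (drop i ps) = ps ! i"
      using that by (auto simp: take_Suc_conv_app_nth hd_drop_conv_nth)
    have "reach_in E (K \<inter> {v. E d v}) (hd (take (Suc i) ps)) (last (take (Suc i) ps))"
      using that s l ps by (intro IH) (auto dest: in_set_takeD)
    moreover have "reach_in E (K \<inter> {v. E d v}) (hd (drop i ps)) (last (drop i ps))"
      using that s l ps by (intro IH) (auto dest: in_set_dropD simp: last_drop)
    ultimately show ?case
      using that ps l by (auto simp: last_drop hd_take intro: rtranclp_trans)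
  qed
  show ?case
  proof (cases "?n \<le> 2")
    case True
    then consider x where "ps = [x]" | x y where "ps = [x, y]"
      using ps(1) by (cases ps; cases "tl ps"; force)
    then show ?thesis
    proof cases
      case 2
      then show ?thesis
        using ps by (intro r_into_rtranclp) (auto simp: induced_adj_def)
    qed auto
  next
    case False
    show ?thesis
    proof (rule ccontr)
      assume contra: "\<not> ?thesis"
      have dist: "distinct ps"
      proof (rule ccontr)
        assume "\<not> distinct ps"
        then obtain i j where ij: "i < j" "j < ?n" "ps ! i = ps ! j"
          unfolding distinct_conv_nth by (metis nat_neq_iff)
        then have "E (ps ! (i - 1)) (ps ! j)" if "i > 0"
          using ps(3) that successively_conv_nth[of E ps] by (metis Suc_diff_1 less_trans)
        moreover have "ps ! j = hd ps" if "i = 0"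
          using that ij ps(1) by (simp add: hd_conv_nth)
        ultimately have ?goal
          using ij by (intro short[of j i]) auto
        then show False
          using contra by contradiction
      qed
      have nsc: "\<not> E (ps ! i) (ps ! j)" if "Suc i < j" "j < ?n" for i j
        using contra short[of j "Suc i"] that by auto
      have "d \<notin> set ps"
        using ps(2) assms(2) by auto
      then have "is_cycle E (d # ps)"
        unfolding is_cycle_def
        using False dist ps sym successively_conv_nth[of E ps]
        by (auto simp: nth_Cons hd_conv_nth split: nat.splits)
      moreover have "\<not> has_chord E (d # ps)"
      proof
        assume "has_chord E (d # ps)"
        then obtain i j where ij: "Suc i < j" "j < Suc ?n" "\<not> (i = 0 \<and> j = ?n)"
          "E ((d # ps) ! i) ((d # ps) ! j)"
          by (auto simp: has_chord_def)
        \<comment> \<open>Position \<open>0\<close> of the cycle is \<open>d\<close>; the other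
          positions are shifted by one against \<open>ps\<close>.\<close>
        show False
        proof (cases i)
          case 0
          then show False
            using ij contra split[of "j - 1"] by (cases j) auto
        next
          case (Suc i')
          then show False
            using ij nsc[of i' "j - 1"] by (cases j) auto
        qed
      qed
      ultimately show False
        using assms(1) False by (auto simp: chordal_def)
    qed
  qed
qed

subsection \<open>Reducible vertices\<close>

text \<open>These hypotheses survive the deletion of a vertex without any restriction of drawings.
  The degree bound is an inequality because a deletion may lower the maximum.\<close>

locale sparse_chordal_graph =
  fixes V :: "'a set" and E :: "'a \<Rightarrow> 'a \<Rightarrow> bool"
  assumes simple: "finite_simple_graph V E"
    and chordal: "chordal E"
    and K4_free: "\<lbrakk>E a b; E a x; E b x; E a y; E b y; E x y\<rbrakk> \<Longrightarrow> False"
    and two_triangles: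
      "\<lbrakk>E a b; E a x; E b x; E a y; E b y; E a z; E b z; x \<noteq> y; x \<noteq> z; y \<noteq> z\<rbrakk> \<Longrightarrow> False"
    and deg_le: "card {u. E v u} \<le> 4"
begin

abbreviation N :: "'a \<Rightarrow> 'a set" where "N v \<equiv> {u. E v u}"

abbreviation N2 :: "'a \<Rightarrow> 'a set" where "N2 v \<equiv> {u. square_adj E v u}"

definition simplicial :: "'a \<Rightarrow> bool" where
  "simplicial v \<longleftrightarrow> (\<forall>x y. E v x \<longrightarrow> E v y \<longrightarrow> x \<noteq> y \<longrightarrow> E x y)"

text \<open>For \<open>D\<close> in \<open>V\<close> disjoint from \<open>A\<close>: a union of
  components of the graph without \<open>A\<close>.\<close>

definition closed_off :: "'a set \<Rightarrow> 'a set \<Rightarrow> bool" where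
  "closed_off D A \<longleftrightarrow> (\<forall>u\<in>D. \<forall>v. E u v \<longrightarrow> v \<in> D \<union> A)"

definition component :: "'a set \<Rightarrow> 'a \<Rightarrow> 'a set" where
  "component A x = {y. reach_in E (- A) x y}"

lemma finite_V: "finite V"
  using simple by (simp add: finite_simple_graph_def)

lemma edge:
  assumes "E u v"
  shows "u \<in> V" "v \<in> V" "u \<noteq> v" "v \<noteq> u" "E v u"
  using simple assms by (auto simp: finite_simple_graph_def)

lemma not_refl [simp]: "\<not> E v v"
  using edge by blast

lemma finite_N [simp]: "finite (N v)"
  by (rule finite_subset[OF _ finite_V]) (use edge in blast)

lemma reach_in_sym:
  assumes "reach_in E K x y"
  shows "reach_in E K y x"
  using assms
proof (induction rule: rtranclp_induct)
  case (step y z)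
  then have "induced_adj K E z y"
    using edge by (auto simp: induced_adj_def)
  then show ?case
    using step.IH by (rule converse_rtranclp_into_rtranclp)
qed simp

text \<open>The search for a reducible vertex uses chordality in this form. Applied to two vertices
  in turn, it moves a connection into their common neighbourhood.\<close>

lemma reach_in_link:
  assumes "E d x" "E d y" "d \<notin> K" "x \<in> K" "reach_in E K x y"
  shows "reach_in E (K \<inter> N d) x y"
proof -
  obtain ps where ps: "ps \<noteq> []" "hd ps = x" "last ps = y" "set ps \<subseteq> K" "successively E ps"
    using reach_in_walk[OF assms(5,4)] .
  then show ?thesis
    using chordal_link_walk[OF chordal assms(3) ps(1,4,5)] assms edge by auto
qed

section \<open>Components after deleting a set of vertices\<close>

lemma component_self: "x \<in> component A x"
  by (simp add: component_def)

lemma component_Int: "x \<notin> A \<Longrightarrow> component A x \<inter> A = {}"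
  unfolding component_def by (auto elim: rtranclp.cases simp: induced_adj_def)

lemma component_closed_off: "x \<notin> A \<Longrightarrow> closed_off (component A x) A"
  unfolding closed_off_def
proof (intro ballI allI impI)
  fix u v assume x: "x \<notin> A" and u: "u \<in> component A x" and uv: "E u v"
  show "v \<in> component A x \<union> A"
  proof (cases "v \<in> A")
    case False
    then have "induced_adj (- A) E u v"
      using component_Int[OF x] u uv by (auto simp: induced_adj_def)
    then show ?thesis
      using u by (auto simp: component_def intro: rtranclp.rtrancl_into_rtrancl)
  qed auto
qed

lemma component_subset:
  assumes "closed_off D A" "x \<in> D"
  shows "component A x \<subseteq> D"
proof
  fix y assume "y \<in> component A x"
  then have "reach_in E (- A) x y"
    by (simp add: component_def)
  then show "y \<in> D"
    using assms by (induction rule: rtranclp_induct) (auto simp: closed_off_def induced_adj_def)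
qed

lemma component_reach:
  assumes "y \<in> component A x" "z \<in> component A x"
  shows "reach_in E (component A x) y z"
proof -
  have *: "reach_in E (component A x) x y" if "reach_in E (- A) x y" for y
    using that
  proof (induction rule: rtranclp_induct)
    case (step y z)
    then have "y \<in> component A x" "z \<in> component A x"
      by (auto simp: component_def intro: rtranclp.rtrancl_into_rtrancl)
    then have "induced_adj (component A x) E y z"
      using step.hyps by (auto simp: induced_adj_def)
    then show ?case
      using step.IH by (rule rtranclp.rtrancl_into_rtrancl[rotated])
  qed simp
  show ?thesis
    using *[of y] *[of z] assms reach_in_sym rtranclp_trans by (metis component_def mem_Collect_eq)
qed

section \<open>Connected sets attached to an edge or a triangle\<close>

lemma reach_in_last_step:
  assumes "reach_in E (insert b K \<inter> S) x b" "x \<noteq> b"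
  obtains z where "z \<in> K" "z \<in> S" "E b z"
  using assms(1)
proof (cases rule: rtranclp.cases)
  case (rtrancl_into_rtrancl z)
  then show ?thesis
    using that edge by (auto simp: induced_adj_def)
qed (use assms in auto)

text \<open>The neighbours \<open>a'\<close> and \<open>b\<close> of \<open>a\<close> are joined
  through \<open>K\<close>. Moved into the link of \<open>a\<close>, this connection reaches
  \<open>b\<close> from a vertex of \<open>K\<close>, which is adjacent to both.\<close>

lemma common_neighbour_in:
  assumes conn: "\<And>x y. x \<in> K \<Longrightarrow> y \<in> K \<Longrightarrow> reach_in E K x y"
    and "a \<notin> K" "b \<notin> K" "E a b" "E a a'" "a' \<in> K" "E b b'" "b' \<in> K"
  obtains w where "w \<in> K" "E a w" "E b w"
proof -
  have "reach_in E (insert b K) a' b'"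
    using conn[OF assms(6,8)] by (rule reach_in_mono) auto
  moreover have "induced_adj (insert b K) E b' b"
    using assms edge by (auto simp: induced_adj_def)
  ultimately have "reach_in E (insert b K) a' b"
    by (rule rtranclp.rtrancl_into_rtrancl)
  then have "reach_in E (insert b K \<inter> N a) a' b"
    using assms by (intro reach_in_link) auto
  moreover have "a' \<noteq> b"
    using assms by auto
  ultimately show ?thesis
    using reach_in_last_step that by (metis mem_Collect_eq)
qed

text \<open>A common neighbour \<open>y\<close> of \<open>a\<close> and \<open>b\<close> in
  \<open>K\<close> is joined to \<open>w\<close> through \<open>K\<close>. Once this connection is
  moved into the links of \<open>a\<close> and \<open>b\<close>, its last vertex before
  \<open>w\<close> completes a K4 with \<open>a\<close>, \<open>b\<close>, \<open>w\<close>.\<close>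

lemma triangle_not_attached:
  assumes conn: "\<And>x y. x \<in> K \<Longrightarrow> y \<in> K \<Longrightarrow> reach_in E K x y"
    and "a \<notin> K" "b \<notin> K" "w \<notin> K" "E a b" "E a w" "E b w"
    and "E a a'" "a' \<in> K" "E b b'" "b' \<in> K" "E w w'" "w' \<in> K"
  shows False
proof -
  obtain y where y: "y \<in> K" "E a y" "E b y"
    using common_neighbour_in[OF conn assms(2,3,5,8-11)] .
  have "reach_in E (insert w K) y w'"
    using conn[OF y(1) assms(13)] by (rule reach_in_mono) auto
  moreover have "induced_adj (insert w K) E w' w"
    using assms edge by (auto simp: induced_adj_def)
  ultimately have "reach_in E (insert w K) y w"
    by (rule rtranclp.rtrancl_into_rtrancl)
  then have "reach_in E (insert w K \<inter> N a) y w"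
    using assms y by (intro reach_in_link) auto
  then have "reach_in E (insert w K \<inter> N a \<inter> N b) y w"
    using assms y edge by (intro reach_in_link[of b y w "insert w K \<inter> N a"]) auto
  moreover have "y \<noteq> w"
    using y assms by auto
  ultimately obtain z where "z \<in> K" "E a z" "E b z" "E w z"
    using reach_in_last_step[of w K "N a \<inter> N b" y] by (auto simp: Int_assoc)
  then show False
    using K4_free assms edge by blast
qed

section \<open>Ears and their neighbours in the square\<close>

lemma card_link_Diff:
  assumes "S \<subseteq> N v"
  shows "card (N v - S) \<le> 4 - card S"
  using card_Diff_subset[of S "N v"] assms deg_le[of v] finite_subset[OF assms] by auto

lemma ear_edges:
  assumes "N w = {a, b}" "E a b"
  shows "E w a" "E w b" "E a w" "E b w" "E b a" "a \<noteq> b" "w \<noteq> a" "w \<noteq> b"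
proof -
  show "E w a" "E w b"
    using assms(1) by auto
  then show "E a w" "E b w" "E b a" "a \<noteq> b" "w \<noteq> a" "w \<noteq> b"
    using assms(2) edge by blast+
qed

text \<open>A connection from \<open>w\<close> to \<open>b1\<close> in the link of \<open>b\<close>
  has to leave \<open>{w, a, x}\<close>, by the degree bound towards \<open>b1\<close>. It does so
  from \<open>x\<close>: \<open>w\<close> has no further neighbour, and leaving from
  \<open>a\<close> would put the edge \<open>ab\<close> into a third triangle.\<close>

lemma link_extends:
  assumes link: "\<And>y. E b y \<Longrightarrow> reach_in E (N b) w y"
    and "N w = {a, b}" "E a b" "x \<noteq> w" "E a x" "E b x" and b1: "E b b1" "b1 \<notin> {w, a, x}"
  shows "E x b1"
proof -
  obtain p q where pq: "induced_adj (N b) E p q" "p \<in> {w, a, x}" "q \<notin> {w, a, x}"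
    using rtranclp_leaves[OF link[OF b1(1)], of "{w, a, x}"] b1(2) by auto
  note wb = ear_edges[OF assms(2,3)]
  have q: "E b q" "E p q"
    using pq by (auto simp: induced_adj_def)
  have sub: "{w, a, x} \<subseteq> N b" and "card {w, a, x} = 3"
    using assms(3-6) wb edge by auto
  then have "card (N b - {w, a, x}) \<le> 1"
    using card_link_Diff[OF sub] by simp
  moreover have "q \<in> N b - {w, a, x}" "b1 \<in> N b - {w, a, x}"
    using q b1 pq(3) by auto
  ultimately have "q = b1"
    using card_le_Suc0_iff_eq[of "N b - {w, a, x}"] by (metis One_nat_def finite_Diff finite_N)
  moreover have "p \<noteq> w"
  proof
    assume "p = w"
    then have "q \<in> {a, b}"
      using q assms(2) by auto
    then show False
      using pq(3) q by auto
  qed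
  moreover have "p \<noteq> a"
    using two_triangles[of a b w x q] q assms wb edge pq(3) by blast
  ultimately show ?thesis
    using pq(2) q by auto
qed

text \<open>Each of \<open>a\<close> and \<open>b\<close> contributes at most two further square
  neighbours. If \<open>b\<close> has any, its connected link forces one, \<open>x\<close>, to be
  common, so more than four arise only if \<open>a1\<close> and \<open>b1\<close> both exist and
  differ. Connectivity is asked of the link of \<open>b\<close> alone, so that \<open>a\<close> may
  be the separating vertex \<open>c\<close>.\<close>

lemma card_N2_ear:
  assumes link: "\<And>y. E b y \<Longrightarrow> reach_in E (N b) w y"
    and w: "N w = {a, b}" "E a b"
    and large: "card (N2 w) > 4"
  obtains x a1 b1 where "distinct [a, b, w, x, a1, b1]" "E a x" "E b x" "E a a1" "E b b1" "E x b1"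
    "card (N2 w) \<le> 5"
proof -
  note wb = ear_edges[OF w]
  have Nw: "E w u \<longleftrightarrow> u = a \<or> u = b" for u
    using w(1) by auto
  have N2: "N2 w \<subseteq> {a, b} \<union> (N a - {w, b}) \<union> (N b - {w, a})"
    by (auto simp: square_adj_iff Nw)
  have "card (N a - {w, b}) \<le> 4 - card {w, b}"
    using w(2) wb by (intro card_link_Diff) auto
  also have "\<dots> = 2"
    using wb by simp
  finally have Na: "card (N a - {w, b}) \<le> 2" .
  have "\<not> N b \<subseteq> {w, a}"
  proof
    assume "N b \<subseteq> {w, a}"
    then have "N2 w \<subseteq> {a, b} \<union> (N a - {w, b})"
      using N2 by auto
    then have "card (N2 w) \<le> card ({a, b} \<union> (N a - {w, b}))"
      by (intro card_mono) auto
    also have "\<dots> \<le> 4"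
      using card_Un_le[of "{a, b}" "N a - {w, b}"] Na wb by auto
    finally show False
      using large by simp
  qed
  then obtain y where y: "E b y" "y \<notin> {w, a}"
    by auto
  \<comment> \<open>An edge of the link leaving \<open>{w, a}\<close> must start at
    \<open>a\<close>, because \<open>w\<close> has no neighbours but \<open>a\<close> and
    \<open>b\<close>. Its other end is the common neighbour.\<close>
  obtain p x where px: "induced_adj (N b) E p x" "p \<in> {w, a}" "x \<notin> {w, a}"
    using rtranclp_leaves[OF link[OF y(1)], of "{w, a}"] y(2) by auto
  then have x: "E b x" "E p x"
    by (auto simp: induced_adj_def)
  have "p \<noteq> w"
  proof
    assume "p = w"
    then have "x \<in> {a, b}"
      using x w(1) by auto
    then show False
      using px(3) x by auto
  qed
  then have ax: "E a x"
    using px(2) x by auto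
  let ?A = "N a - {w, b, x}" and ?B = "N b - {w, a, x}"
  have "b \<noteq> x"
    using x by auto
  then have A: "card ?A \<le> 1"
    using card_link_Diff[of "{w, b, x}" a] wb ax w(2) px(3) by auto
  have B: "card ?B \<le> 1"
    using card_link_Diff[of "{w, a, x}" b] wb x w(2) px(3) by auto
  have N2': "card (N2 w) \<le> card ({a, b, x} \<union> (?A \<union> ?B))"
    using N2 by (intro card_mono) auto
  have "card ({a, b, x} \<union> (?A \<union> ?B)) \<le> 3 + card (?A \<union> ?B)"
    using card_Un_le[of "{a, b, x}" "?A \<union> ?B"] card_insert_le_m1[of 3 "{b, x}" a]
      card_insert_le_m1[of 2 "{x}" b] by auto
  then have AB: "card (N2 w) \<le> 3 + card (?A \<union> ?B)"
    using N2' by simp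
  then have "card (?A \<union> ?B) \<ge> 2"
    using large by simp
  moreover have le: "card (?A \<union> ?B) \<le> card ?A + card ?B"
    by (rule card_Un_le)
  ultimately have "card ?A = 1" "card ?B = 1"
    using A B by linarith+
  then obtain a1 b1 where ab1: "?A = {a1}" "?B = {b1}"
    by (meson card_1_singletonE)
  have "a1 \<noteq> b1"
    using \<open>card (?A \<union> ?B) \<ge> 2\<close> unfolding ab1 by auto
  have a1: "E a a1" "a1 \<notin> {w, b, x}" and b1: "E b b1" "b1 \<notin> {w, a, x}"
    using ab1 by blast+
  have "E x b1"
    using link_extends[OF link w _ ax x(1) b1] px(3) by auto
  moreover have "distinct [a, b, w, x, a1, b1]"
    using wb px(3) a1 b1 \<open>b \<noteq> x\<close> \<open>a1 \<noteq> b1\<close> by auto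
  moreover have "card (N2 w) \<le> 5"
    using AB le A B by linarith
  ultimately show ?thesis
    using that ax x a1 b1 by blast
qed

lemma F4_subgraphI:
  assumes "distinct [a, b, w, x, a1, b1]"
    and "E a b" "E b x" "E a x" "E w a" "E w b" "E b1 b" "E b1 x" "E a1 a" "E a1 x"
  shows "has_subgraph V E F4_verts F4_adj"
proof -
  \<comment> \<open>The triangle is \<open>a b x\<close>; the vertices \<open>w\<close>,
    \<open>b1\<close>, \<open>a1\<close> sit on its edges \<open>ab\<close>, \<open>bx\<close>,
    \<open>ax\<close>.\<close>
  define f where "f = (\<lambda>n::nat. [a, b, x, w, b1, a1] ! n)"
  have f: "f 0 = a" "f 1 = b" "f 2 = x" "f 3 = w" "f 4 = b1" "f 5 = a1"
    by (simp_all add: f_def)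
  have "inj_on f F4_verts"
    using assms(1) f by (auto simp: F4_verts_def inj_on_def)
  moreover have "f ` F4_verts \<subseteq> V"
    using assms f edge by (auto simp: F4_verts_def)
  moreover have "E (f u) (f v)" if "F4_adj u v" for u v
    using that assms(2-) f edge(5) by (auto simp: F4_adj_def doubleton_eq_iff)
  ultimately show ?thesis
    by (auto simp: has_subgraph_def)
qed

definition reducible :: "'a \<Rightarrow> bool" where
  "reducible v \<longleftrightarrow> v \<in> V \<and> simplicial v \<and>
     (card (N2 v) \<le> 4 \<or> card (N2 v) \<le> 5 \<and> has_subgraph V E F4_verts F4_adj)"

lemma leaf_reducible:
  assumes "v \<in> V" "\<And>x y. E v x \<Longrightarrow> E v y \<Longrightarrow> x = y"
  shows "reducible v"
proof (cases "N v = {}")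
  case True
  then have "N2 v = {}"
    by (auto simp: square_adj_iff)
  then show ?thesis
    using assms by (auto simp: reducible_def simplicial_def)
next
  case False
  then obtain a where a: "E v a" and Nv: "N v = {a}"
    using assms by blast
  have "E v u \<longleftrightarrow> u = a" for u
    using Nv by auto
  then have "N2 v \<subseteq> insert a (N a - {v})"
    by (auto simp: square_adj_iff)
  then have "card (N2 v) \<le> card (insert a (N a - {v}))"
    by (intro card_mono) auto
  also have "\<dots> \<le> 4"
    using card_link_Diff[of "{v}" a] a edge by (auto simp: card_insert_if)
  finally show ?thesis
    using assms by (auto simp: reducible_def simplicial_def)
qed

lemma ear_simplicial:
  assumes "N w = {a, b}" "E a b"
  shows "simplicial w"
  unfolding simplicial_def
proof (intro allI impI)
  fix x y assume "E w x" "E w y" "x \<noteq> y"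
  then have "x \<in> {a, b}" "y \<in> {a, b}"
    using assms(1) by auto
  then show "E x y"
    using \<open>x \<noteq> y\<close> assms(2) edge by auto
qed

end

text \<open>An end block with its attaching vertex \<open>c\<close>. Since \<open>minimal\<close>
  allows any \<open>a\<close> in place of \<open>c\<close>, no nonempty proper part of
  \<open>C\<close> is separated by a single vertex. In a 2-connected graph \<open>C\<close> is
  \<open>V - {c}\<close>.\<close>

locale minimal_lobe = sparse_chordal_graph V E for V :: "'a set" and E +
  fixes C :: "'a set" and c :: 'a
  assumes C: "C \<noteq> {}" "C \<subseteq> V" "c \<in> V" "c \<notin> C" "closed_off C {c}"
    and minimal: "\<lbrakk>K \<subset> C; K \<noteq> {}; a \<in> V; a \<notin> K; closed_off K {a}\<rbrakk> \<Longrightarrow> False"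
    and two_neighbours: "v \<in> V \<Longrightarrow> \<exists>x y. E v x \<and> E v y \<and> x \<noteq> y"
begin

lemma N_subset: "v \<in> C \<Longrightarrow> E v x \<Longrightarrow> x \<in> insert c C"
  using C(5) by (auto simp: closed_off_def)

lemma ear_exists:
  assumes "C \<subseteq> X" "X \<subseteq> insert c C"
    and "D \<noteq> {}" "D \<subseteq> C" "a \<in> X" "b \<in> X" "a \<notin> D" "b \<notin> D" "E a b" "closed_off D {a, b}"
  shows "\<exists>w a b. w \<in> C \<and> a \<in> X \<and> b \<in> X \<and> E a b \<and> N w = {a, b}"
  using assms(3-)
proof (induction "card D" arbitrary: D a b rule: less_induct)
  case less
  have V: "a \<in> V" "b \<in> V" "a \<noteq> b"
    using edge less.prems by auto
  have fin: "finite D"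
    using less.prems(2) C(2) finite_V by (meson finite_subset)
  \<comment> \<open>One of the distinct vertices \<open>a\<close>, \<open>b\<close> is not
    \<open>c\<close>, so it lies in \<open>C\<close> but not in \<open>D\<close>.\<close>
  have DC: "D \<subset> C"
    using less.prems V(3) assms(2) by blast
  obtain x where x: "x \<in> D"
    using less.prems by auto
  define K where "K = component {a, b} x"
  have xab: "x \<notin> {a, b}"
    using x less.prems by auto
  have K: "K \<subseteq> D" "x \<in> K" "closed_off K {a, b}" "a \<notin> K" "b \<notin> K"
    using component_subset[OF less.prems(8) x] component_self component_closed_off[OF xab]
      component_Int[OF xab] by (auto simp: K_def)
  have "\<exists>u\<in>K. E a u"
  proof (rule ccontr)
    assume "\<not> ?thesis"
    then have "closed_off K {b}"
      using K(3) edge unfolding closed_off_def by blast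
    then show False
      using minimal[of K b] K DC V by auto
  qed
  moreover have "\<exists>u\<in>K. E b u"
  proof (rule ccontr)
    assume "\<not> ?thesis"
    then have "closed_off K {a}"
      using K(3) edge unfolding closed_off_def by blast
    then show False
      using minimal[of K a] K DC V by auto
  qed
  ultimately obtain w where w: "w \<in> K" "E a w" "E b w"
    using common_neighbour_in[of K a b] component_reach[of _ "{a, b}" x] K(4,5) less.prems(7)
    unfolding K_def by metis
  show ?case
  proof (cases "K = {w}")
    case True
    then have "N w = {a, b}"
      using K(3) w edge by (auto simp: closed_off_def)
    then show ?thesis
      using w K less.prems by blast
  next
    case False
    then obtain y where y: "y \<in> K" "y \<noteq> w"
      using w by blast
    define L where "L = component {a, b, w} y"
    have yab: "y \<notin> {a, b, w}"
      using y K by auto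
    have "closed_off (K - {w}) {a, b, w}"
      using K(3) by (auto simp: closed_off_def)
    then have L: "L \<subseteq> K - {w}" "y \<in> L" "closed_off L {a, b, w}" "a \<notin> L" "b \<notin> L" "w \<notin> L"
      using component_subset[of "K - {w}" "{a, b, w}" y] y component_self
        component_closed_off[OF yab] component_Int[OF yab] by (auto simp: L_def)
    have LD: "card L < card D" "L \<subseteq> C" "L \<noteq> {}"
      using L K w DC fin by (auto intro!: psubset_card_mono)
    have wX: "w \<in> X"
      using w K DC assms(1) by auto
    note IH = less.hyps[OF LD(1) LD(3,2)]
    show ?thesis
    proof (cases "(\<exists>u\<in>L. E a u) \<and> (\<exists>u\<in>L. E b u) \<and> (\<exists>u\<in>L. E w u)")
      case True
      then show ?thesis
        using triangle_not_attached[of L a b w] component_reach[of _ "{a, b, w}" y] L(4-6) w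
          less.prems(7) unfolding L_def by metis
    next
      case False
      then consider "\<forall>u\<in>L. \<not> E a u" | "\<forall>u\<in>L. \<not> E b u" | "\<forall>u\<in>L. \<not> E w u"
        by blast
      then show ?thesis
      proof cases
        case 1
        then have "closed_off L {b, w}"
          using L(3) edge unfolding closed_off_def by blast
        then show ?thesis
          using IH[of b w] less.prems wX L w by auto
      next
        case 2
        then have "closed_off L {a, w}"
          using L(3) edge unfolding closed_off_def by blast
        then show ?thesis
          using IH[of a w] less.prems wX L w by auto
      next
        case 3
        then have "closed_off L {a, b}"
          using L(3) edge unfolding closed_off_def by blast
        then show ?thesis
          using IH[of a b] less.prems wX L w by auto
      qed
    qed
  qed
qed

text \<open>A neighbour of \<open>b\<close> not joined to \<open>c\<close> off \<open>b\<close>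
  would lie in a smaller set separated by \<open>b\<close> alone. So any two neighbours are joined
  via \<open>c\<close>, and chordality moves the connection into the link.\<close>

lemma link_connected:
  assumes b: "b \<in> C" and w: "E b w" and y: "E b y"
  shows "reach_in E (N b) w y"
proof -
  have cb: "c \<noteq> b"
    using C b by auto
  have c_reach: "reach_in E (- {b}) y c" if y: "E b y" for y
  proof (rule ccontr)
    define K where "K = component {b} y"
    assume "\<not> ?thesis"
    then have c: "c \<notin> K"
      by (simp add: K_def component_def)
    have yb: "y \<notin> {b}"
      using y by auto
    have K: "closed_off K {b}" "y \<in> K" "b \<notin> K"
      using component_closed_off[OF yb] component_self component_Int[OF yb] by (auto simp: K_def)
    have "closed_off (C \<inter> K) {b}"
      using K(1) C(5) c cb unfolding closed_off_def by blast
    moreover have "y \<in> C \<inter> K"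
      using N_subset[OF b y] K(2) c by auto
    ultimately show False
      using minimal[of "C \<inter> K" b] b K C(2) by blast
  qed
  have "reach_in E (- {b}) w y"
    using c_reach[OF w] reach_in_sym[OF c_reach[OF y]] by (rule rtranclp_trans)
  then have "reach_in E (- {b} \<inter> N b) w y"
    using w y edge by (intro reach_in_link) auto
  then show ?thesis
    by (rule reach_in_mono) auto
qed

text \<open>The links of both \<open>a\<close> and \<open>b\<close> are connected, so with five
  square neighbours \<open>x\<close> is adjacent to \<open>a1\<close> as well as to
  \<open>b1\<close>, which completes the copy of \<open>F4\<close>.\<close>

lemma inner_ear_reducible:
  assumes "w \<in> C" "a \<in> C" "b \<in> C" "E a b" "N w = {a, b}"
  shows "reducible w"
proof (cases "card (N2 w) \<le> 4")
  case True
  then show ?thesis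
    using assms ear_simplicial C by (auto simp: reducible_def)
next
  case False
  note wb = ear_edges[OF assms(5,4)]
  obtain x a1 b1 where d: "distinct [a, b, w, x, a1, b1]"
    and x: "E a x" "E b x" "E a a1" "E b b1" "E x b1" "card (N2 w) \<le> 5"
    using card_N2_ear[OF link_connected[OF assms(3) wb(4)] assms(5,4)] False by auto
  \<comment> \<open>With \<open>a\<close> and \<open>b\<close> exchanged,
    \<open>link_extends\<close> applies to the link of \<open>a\<close>.\<close>
  have "N w = {b, a}"
    using assms(5) by auto
  then have "E x a1"
    using link_extends[OF link_connected[OF assms(2) wb(3)] _ wb(5) _ x(2,1,3)] d by auto
  then have "has_subgraph V E F4_verts F4_adj"
    using x wb assms(4) edge by (intro F4_subgraphI[OF d]) auto
  then show ?thesis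
    using assms ear_simplicial C x by (auto simp: reducible_def)
qed

text \<open>With five square neighbours, the edge \<open>bx\<close> separates \<open>b1\<close> from
  \<open>c\<close>: a connection off \<open>b\<close> and \<open>x\<close> could be moved into both
  links, and its first step would complete a K4 on \<open>b\<close>, \<open>x\<close>,
  \<open>b1\<close>. Then \<open>bx\<close> cuts off a part of \<open>C\<close>, which
  \<open>none\<close> excludes.\<close>

lemma outer_ear_reducible:
  assumes "w \<in> C" "b \<in> C" "E c b" "N w = {c, b}"
    and none: "\<And>D a b. \<lbrakk>D \<noteq> {}; D \<subseteq> C; a \<in> C; b \<in> C; a \<notin> D; b \<notin> D; E a b; closed_off D {a, b}\<rbrakk> \<Longrightarrow> False"
  shows "reducible w"
proof (cases "card (N2 w) \<le> 4")
  case True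
  then show ?thesis
    using assms ear_simplicial C by (auto simp: reducible_def)
next
  case False
  note wb = ear_edges[OF assms(4,3)]
  obtain x a1 b1 where d: "distinct [c, b, w, x, a1, b1]"
    and x: "E c x" "E b x" "E c a1" "E b b1" "E x b1" "card (N2 w) \<le> 5"
    using card_N2_ear[OF link_connected[OF assms(2) wb(4)] assms(4,3)] False by auto
  have xC: "x \<in> C" "b1 \<in> C"
    using N_subset[OF assms(2)] x d by auto
  define K where "K = component {b, x} b1"
  have b1: "b1 \<notin> {b, x}"
    using d by auto
  have K: "closed_off K {b, x}" "b1 \<in> K" "b \<notin> K" "x \<notin> K"
    using component_closed_off[OF b1] component_self component_Int[OF b1] by (auto simp: K_def)
  have "c \<notin> K"
  proof
    assume "c \<in> K"
    then have "reach_in E (- {b, x}) b1 c"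
      by (simp add: K_def component_def)
    then have "reach_in E (- {b, x} \<inter> N b) b1 c"
      using x assms(3) b1 edge by (intro reach_in_link) auto
    then have "reach_in E (- {b, x} \<inter> N b \<inter> N x) b1 c"
      using x b1 edge by (intro reach_in_link[of x b1 c "- {b, x} \<inter> N b"]) auto
    then show False
    proof (cases rule: converse_rtranclpE)
      case (step q)
      then show ?thesis
        using K4_free[of b x b1 q] x by (auto simp: induced_adj_def)
    qed (use d in auto)
  qed
  then have "closed_off (C \<inter> K) {b, x}"
    using K(1) C(4,5) assms(2) xC unfolding closed_off_def by blast
  then have False
    using none[of "C \<inter> K" b x] K assms(2) xC x(2) by blast
  then show ?thesis ..
qed

text \<open>If an edge within \<open>C\<close> cuts off a part of \<open>C\<close>, there is an ear
  with both ends in \<open>C\<close>. Otherwise the search starts from an edge at \<open>c\<close>,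
  and an ear found at \<open>c\<close> meets the condition \<open>none\<close>.\<close>

lemma reducible_vertex_exists: "\<exists>w. reducible w"
proof (cases "\<exists>D a b. D \<noteq> {} \<and> D \<subseteq> C \<and> a \<in> C \<and> b \<in> C \<and> a \<notin> D \<and> b \<notin> D \<and> E a b \<and> closed_off D {a, b}")
  case True
  then obtain D a b where "D \<noteq> {}" "D \<subseteq> C" "a \<in> C" "b \<in> C" "a \<notin> D" "b \<notin> D" "E a b"
    "closed_off D {a, b}"
    by blast
  then show ?thesis
    using ear_exists[of C D a b] inner_ear_reducible by blast
next
  case False
  then have none: "\<And>D a b. \<lbrakk>D \<noteq> {}; D \<subseteq> C; a \<in> C; b \<in> C; a \<notin> D; b \<notin> D; E a b; closed_off D {a, b}\<rbrakk> \<Longrightarrow> False"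
    by blast
  \<comment> \<open>Otherwise no edge leaves \<open>C\<close>, and removing any vertex
    \<open>v\<close> from \<open>C\<close> leaves a smaller set separated by
    \<open>v\<close>.\<close>
  have "\<exists>d\<in>C. E c d"
  proof (rule ccontr)
    assume no: "\<not> ?thesis"
    obtain v where v: "v \<in> C"
      using C by auto
    obtain u where u: "E v u"
      using two_neighbours v C by blast
    then have "u \<in> C - {v}"
      using N_subset[OF v u] no v edge by auto
    moreover have "closed_off (C - {v}) {v}"
      using C(5) no edge(5) unfolding closed_off_def by blast
    ultimately show False
      using minimal[of "C - {v}" v] v C by auto
  qed
  then obtain d where d: "d \<in> C" "E c d"
    by auto
  \<comment> \<open>This second neighbour shows that \<open>C - {d}\<close>, which the edge
    \<open>cd\<close> cuts off, is nonempty.\<close>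
  obtain y where y: "E d y" "y \<noteq> c"
    using two_neighbours[of d] d C by blast
  have "y \<in> C - {d}"
    using N_subset[OF d(1) y(1)] y edge by auto
  moreover have "closed_off (C - {d}) {c, d}"
    using C(5) by (auto simp: closed_off_def)
  ultimately obtain w a b where w: "w \<in> C" "a \<in> insert c C" "b \<in> insert c C" "E a b" "N w = {a, b}"
    using ear_exists[of "insert c C" "C - {d}" c d] d C by blast
  consider "a \<in> C" "b \<in> C" | "a = c" "b \<in> C" | "a \<in> C" "b = c"
    using w edge by blast
  then show ?thesis
  proof cases
    case 1
    then show ?thesis
      using inner_ear_reducible w by blast
  next
    case 2
    then show ?thesis
      using outer_ear_reducible[of w b] w none by blast
  next
    case 3
    then have "E c a" "N w = {c, a}"
      using w edge by auto
    then show ?thesis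
      using outer_ear_reducible[of w a] w 3 none by blast
  qed
qed

end

section \<open>Elimination of reducible vertices\<close>

context sparse_chordal_graph
begin

theorem ex_reducible:
  assumes "V \<noteq> {}"
  shows "\<exists>v. reducible v"
proof (cases "\<exists>v\<in>V. \<forall>x y. E v x \<longrightarrow> E v y \<longrightarrow> x = y")
  case True
  then show ?thesis
    using leaf_reducible by blast
next
  case False
  \<comment> \<open>The pair \<open>(V - {v}, v)\<close> is admissible for any vertex
    \<open>v\<close>, so a smallest \<open>C\<close> exists, smallest over all separating vertices
    at once.\<close>
  define P where "P = (\<lambda>(C, c). C \<noteq> {} \<and> C \<subseteq> V \<and> c \<in> V \<and> c \<notin> C \<and> closed_off C {c})"
  obtain v where v: "v \<in> V"
    using assms by auto
  then obtain x where x: "E v x"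
    using False by blast
  have "x \<in> V - {v}"
    using edge[OF x] by auto
  then have "P (V - {v}, v)"
    using v edge by (auto simp: P_def closed_off_def)
  then obtain Cc where Cc: "P Cc" "\<And>Cc'. P Cc' \<Longrightarrow> card (fst Cc) \<le> card (fst Cc')"
    using ex_has_least_nat[of P _ "\<lambda>Cc. card (fst Cc)"] by blast
  obtain C c where CC: "Cc = (C, c)"
    by (cases Cc)
  interpret minimal_lobe V E C c
  proof
    fix K a assume K: "K \<subset> C" "K \<noteq> {}" "a \<in> V" "a \<notin> K" "closed_off K {a}"
    then have "P (K, a)"
      using Cc(1) by (auto simp: P_def CC)
    then have "card C \<le> card K"
      using Cc(2)[of "(K, a)"] by (simp add: CC)
    moreover have "finite C"
      using Cc(1) finite_V by (auto simp: P_def CC intro: finite_subset)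
    ultimately show False
      using psubset_card_mono[OF _ K(1)] by simp
  qed (use Cc(1) False in \<open>auto simp: P_def CC\<close>)
  show ?thesis
    by (rule reducible_vertex_exists)
qed

end

text \<open>A path of length two through \<open>v\<close> joins neighbours of \<open>v\<close>,
  which are adjacent, so the square does not change elsewhere. Chords survive because their ends lie
  on the cycle.\<close>

lemma (in sparse_chordal_graph) remove_simplicial:
  assumes "simplicial v"
  shows "sparse_chordal_graph (V - {v}) (induced_adj (V - {v}) E)"
    and "\<And>x y. \<lbrakk>x \<in> V - {v}; y \<in> V - {v}\<rbrakk> \<Longrightarrow>
      square_adj (induced_adj (V - {v}) E) x y \<longleftrightarrow> square_adj E x y"
proof -
  let ?E = "induced_adj (V - {v}) E"
  have sub: "?E x y \<Longrightarrow> E x y" for x y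
    by (simp add: induced_adj_def)
  show "sparse_chordal_graph (V - {v}) ?E"
  proof
    show "finite_simple_graph (V - {v}) ?E"
      using simple by (auto simp: finite_simple_graph_def induced_adj_def)
    show "chordal ?E"
      unfolding chordal_def
    proof (intro allI impI, elim conjE)
      fix xs assume cyc: "is_cycle ?E xs" and len: "4 \<le> length xs"
      have "is_cycle E xs"
        using cyc sub by (auto simp: is_cycle_def)
      then obtain i j where ij: "Suc i < j" "j < length xs" "\<not> (i = 0 \<and> j = length xs - 1)"
        "E (xs ! i) (xs ! j)"
        using chordal len by (auto simp: chordal_def has_chord_def)
      \<comment> \<open>The last entry has no successor in the list; the closing edge covers
        it.\<close>
      have in_V: "xs ! n \<in> V - {v}" if "n < length xs" for n
      proof (cases "Suc n < length xs")
        case True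
        then show ?thesis
          using cyc by (auto simp: is_cycle_def induced_adj_def)
      next
        case False
        then have "xs ! n = last xs"
          using that by (cases xs rule: rev_cases) (auto simp: nth_append)
        then show ?thesis
          using cyc by (auto simp: is_cycle_def induced_adj_def)
      qed
      then show "has_chord ?E xs"
        unfolding has_chord_def using ij
        by (intro exI[of _ i] exI[of _ j]) (auto simp: induced_adj_def)
    qed
    show "card {u. ?E x u} \<le> 4" for x
    proof -
      have "card {u. ?E x u} \<le> card (N x)"
        by (intro card_mono) (auto simp: induced_adj_def)
      then show ?thesis
        using deg_le[of x] by linarith
    qed
  qed (use sub K4_free two_triangles in \<open>meson+\<close>)
  show "square_adj ?E x y \<longleftrightarrow> square_adj E x y" if "x \<in> V - {v}" "y \<in> V - {v}" for x y
  proof -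
    have "E x y" if "E x v" "E v y" "x \<noteq> y"
      using that assms edge(5)[of x v] unfolding simplicial_def by blast
    then show ?thesis
      using that edge(1,2,5) unfolding square_adj_iff induced_adj_def
      by (metis DiffD2 DiffI singletonD singletonI)
  qed
qed

text \<open>Reducible vertices are deleted until one lies in \<open>W\<close>. Up to then the square
  on \<open>W\<close> is unchanged, so the bound for that vertex is valid in
  \<open>W\<close>.\<close>

lemma square_degenerate:
  assumes "sparse_chordal_graph V E" "W \<subseteq> V" "W \<noteq> {}" "4 \<le> k"
    and "has_subgraph V E F4_verts F4_adj \<Longrightarrow> 5 \<le> k"
  shows "\<exists>w\<in>W. card {u \<in> W. square_adj E w u} \<le> k"
  using assms(1-3,5)
proof (induction "card V" arbitrary: V E rule: less_induct)
  case less
  interpret sparse_chordal_graph V E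
    by fact
  obtain v where v: "v \<in> V" "simplicial v"
    "card (N2 v) \<le> 4 \<or> card (N2 v) \<le> 5 \<and> has_subgraph V E F4_verts F4_adj"
    using ex_reducible less.prems by (auto simp: reducible_def)
  have fin: "finite (N2 v)"
    by (rule finite_subset[OF _ finite_V]) (use edge in \<open>auto simp: square_adj_iff\<close>)
  show ?case
  proof (cases "v \<in> W")
    case True
    have "card {u \<in> W. square_adj E v u} \<le> card (N2 v)"
      using fin by (intro card_mono) auto
    also have "\<dots> \<le> k"
      using v(3) assms(4) less.prems(4) by linarith
    finally show ?thesis
      using True by blast
  next
    case False
    let ?V = "V - {v}"
    let ?E = "induced_adj ?V E"
    note G' = remove_simplicial[OF v(2)]
    have "card ?V < card V"
      using card_Diff1_less[OF finite_V v(1)] .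
    \<comment> \<open>A copy of \<open>F4\<close> left after the deletion was there before, so the
      condition on \<open>k\<close> is inherited.\<close>
    moreover have "has_subgraph V E F4_verts F4_adj" if "has_subgraph ?V ?E F4_verts F4_adj"
      using that unfolding has_subgraph_def induced_adj_def by blast
    moreover have sub: "W \<subseteq> ?V"
      using False less.prems by auto
    ultimately obtain w where w: "w \<in> W" "card {u \<in> W. square_adj ?E w u} \<le> k"
      using less.hyps[of ?V ?E] G'(1) less.prems by blast
    have "{u \<in> W. square_adj ?E w u} = {u \<in> W. square_adj E w u}"
      using G'(2)[of w] w(1) sub by blast
    then show ?thesis
      using w by auto
  qed
qed

subsection \<open>Colouring squares\<close>

text \<open>Greedy colouring: the vertex coloured last sees at most \<open>k\<close> of the
  \<open>Suc k\<close> colours.\<close>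

lemma degenerate_coloring:
  assumes "finite V" and sym: "\<And>x y. R x y \<Longrightarrow> R y x" and irrefl: "\<And>x. \<not> R x x"
    and degen: "\<And>W. \<lbrakk>W \<subseteq> V; W \<noteq> {}\<rbrakk> \<Longrightarrow> \<exists>w\<in>W. card {u \<in> W. R w u} \<le> k"
  shows "\<exists>c. proper_coloring V R c \<and> c ` V \<subseteq> {..<Suc k}"
proof -
  have "\<exists>c. proper_coloring W R c \<and> c ` W \<subseteq> {..<Suc k}" if "W \<subseteq> V" for W
    using that
  proof (induction "card W" arbitrary: W rule: less_induct)
    case less
    show ?case
    proof (cases "W = {}")
      case False
      then obtain w where w: "w \<in> W" "card {u \<in> W. R w u} \<le> k"
        using degen less.prems by blast
      have fin: "finite W"
        using less.prems assms(1) finite_subset by blast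
      have "card (W - {w}) < card W"
        using card_Diff1_less[OF fin w(1)] .
      then obtain c where c: "proper_coloring (W - {w}) R c" "c ` (W - {w}) \<subseteq> {..<Suc k}"
        using less.hyps[of "W - {w}"] less.prems by auto
      have "card (c ` {u \<in> W. R w u}) < card {..<Suc k}"
        using card_image_le[of "{u \<in> W. R w u}" c] fin w(2) by auto
      then have "\<not> {..<Suc k} \<subseteq> c ` {u \<in> W. R w u}"
        using card_mono[of "c ` {u \<in> W. R w u}" "{..<Suc k}"] fin by auto
      then obtain n where n: "n < Suc k" "n \<notin> c ` {u \<in> W. R w u}"
        by auto
      have "proper_coloring W R (c(w := n))"
        unfolding proper_coloring_def
      proof (intro ballI impI)
        fix x y assume xy: "x \<in> W" "y \<in> W" "R x y"
        then have "c x \<noteq> n" if "y = w"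
          using that n(2) sym by blast
        moreover have "c y \<noteq> n" if "x = w"
          using that n(2) xy by blast
        moreover have "x \<noteq> y"
          using xy irrefl by blast
        ultimately show "(c(w := n)) x \<noteq> (c(w := n)) y"
          using c(1) xy by (auto simp: proper_coloring_def)
      qed
      moreover have "(c(w := n)) ` W \<subseteq> {..<Suc k}"
        using c(2) n(1) by auto
      ultimately show ?thesis
        by blast
    qed (auto simp: proper_coloring_def)
  qed
  then show ?thesis
    by blast
qed

lemma clique_card_le_colors:
  assumes "is_clique V R K" "proper_coloring V R c" "c ` V \<subseteq> {..<m}"
  shows "card K \<le> m"
proof -
  have "inj_on c K"
    using assms(1,2) unfolding is_clique_def proper_coloring_def by (meson inj_onI subsetD)
  moreover have "c ` K \<subseteq> {..<m}"
    using assms(1,3) by (auto simp: is_clique_def)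
  ultimately show ?thesis
    using card_inj_on_le[of c K "{..<m}"] by simp
qed

lemma clique_le_inductiveness:
  assumes "finite V" "is_clique V R K" "card K = Suc k" "\<And>x. \<not> R x x"
  shows "k \<le> inductiveness V R"
proof -
  have K: "K \<subseteq> V" "K \<noteq> {}" "finite K"
    using assms by (auto simp: is_clique_def intro: finite_subset)
  have "vertex_degree (induced_adj K R) x = k" if "x \<in> K" for x
  proof -
    have "{u. induced_adj K R x u} = K - {x}"
      using assms(2,4) that by (auto simp: is_clique_def induced_adj_def)
    then show ?thesis
      using that K(3) assms(3) by (simp add: vertex_degree_def)
  qed
  then have "min_degree K (induced_adj K R) = k"
    using K(2) by (simp add: min_degree_def)
  moreover have "min_degree K (induced_adj K R) \<le> inductiveness V R"
    unfolding inductiveness_def using K assms(1)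
    by (intro cSUP_upper bdd_above_finite finite_imageI) auto
  ultimately show ?thesis
    by simp
qed

lemma degenerate_inductiveness_le:
  assumes "V \<noteq> {}" and degen: "\<And>W. \<lbrakk>W \<subseteq> V; W \<noteq> {}\<rbrakk> \<Longrightarrow> \<exists>w\<in>W. card {u \<in> W. R w u} \<le> k"
  shows "inductiveness V R \<le> k"
  unfolding inductiveness_def
proof (rule cSUP_least)
  fix W assume "W \<in> {W. W \<subseteq> V \<and> W \<noteq> {}}"
  then obtain w where w: "w \<in> W" "card {u \<in> W. R w u} \<le> k"
    using degen by blast
  have "min_degree W (induced_adj W R) \<le> vertex_degree (induced_adj W R) w"
    unfolding min_degree_def using w(1) by (intro cINF_lower) auto
  also have "\<dots> \<le> k"
    using w by (simp add: vertex_degree_def induced_adj_def)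
  finally show "min_degree W (induced_adj W R) \<le> k" .
qed (use assms(1) in auto)

text \<open>The clique bounds all three parameters from below, degeneracy bounds them from
  above.\<close>

lemma tight_degenerate_graph:
  assumes "finite V" and sym: "\<And>x y. R x y \<Longrightarrow> R y x" and irrefl: "\<And>x. \<not> R x x"
    and degen: "\<And>W. \<lbrakk>W \<subseteq> V; W \<noteq> {}\<rbrakk> \<Longrightarrow> \<exists>w\<in>W. card {u \<in> W. R w u} \<le> k"
    and K: "is_clique V R K" "card K = Suc k"
  shows "clique_number V R = Suc k \<and> chromatic_number V R = Suc k \<and> inductiveness V R + 1 = Suc k"
proof (intro conjI)
  obtain c where c: "proper_coloring V R c" "c ` V \<subseteq> {..<Suc k}"
    using degenerate_coloring[OF assms(1) sym irrefl degen] by blast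
  have le: "n \<le> Suc k" if "n \<in> {card K | K. is_clique V R K}" for n
    using that clique_card_le_colors[OF _ c] by auto
  show "clique_number V R = Suc k"
    unfolding clique_number_def
  proof (rule Max_eqI[OF _ le])
    show "finite {card K | K. is_clique V R K}"
      by (rule finite_subset[of _ "{..Suc k}"]) (use le in blast)+
    show "Suc k \<in> {card K | K. is_clique V R K}"
      using K by force
  qed
  show "chromatic_number V R = Suc k"
    unfolding chromatic_number_def
  proof (rule Least_equality)
    show "\<exists>c. proper_coloring V R c \<and> c ` V \<subseteq> {..<Suc k}"
      using c by blast
    show "Suc k \<le> m" if "\<exists>c. proper_coloring V R c \<and> c ` V \<subseteq> {..<m}" for m
      using that clique_card_le_colors[OF K(1)] K(2) by metis
  qed
  have "V \<noteq> {}"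
    using K by (auto simp: is_clique_def)
  then show "inductiveness V R + 1 = Suc k"
    using degenerate_inductiveness_le[OF _ degen] clique_le_inductiveness[OF assms(1) K irrefl]
    by (simp add: le_antisym)
qed

section \<open>Large cliques in the square\<close>

lemma F4_diameter:
  assumes "u \<in> F4_verts" "v \<in> F4_verts" "u \<noteq> v"
  shows "F4_adj u v \<or> (\<exists>x\<in>F4_verts. F4_adj u x \<and> F4_adj x v)"
  using assms unfolding F4_verts_def F4_adj_def
  by (elim insertE emptyE) (simp_all add: doubleton_eq_iff)

text \<open>An embedding maps walks to walks, so the diameter 2 of \<open>F4\<close> makes its six
  images pairwise adjacent in the square.\<close>

lemma F4_square_clique:
  assumes "has_subgraph V E F4_verts F4_adj"
  obtains K where "is_clique V (square_adj E) K" "card K = 6"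
proof -
  obtain f where f: "inj_on f F4_verts" "f ` F4_verts \<subseteq> V"
    "\<And>u v. \<lbrakk>u \<in> F4_verts; v \<in> F4_verts; F4_adj u v\<rbrakk> \<Longrightarrow> E (f u) (f v)"
    using assms unfolding has_subgraph_def by blast
  have "square_adj E (f u) (f v)" if "u \<in> F4_verts" "v \<in> F4_verts" "f u \<noteq> f v" for u v
    using F4_diameter[of u v] that f(3) unfolding square_adj_iff by metis
  then have "is_clique V (square_adj E) (f ` F4_verts)"
    using f(2) by (auto simp: is_clique_def)
  moreover have "card (f ` F4_verts) = 6"
    using card_image[OF f(1)] by (simp add: F4_verts_def)
  ultimately show ?thesis
    using that by blast
qed

lemma closed_neighbourhood_square_clique:
  assumes "finite_simple_graph V E" "v \<in> V"
  shows "is_clique V (square_adj E) (insert v {u. E v u})"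
    and "card (insert v {u. E v u}) = Suc (vertex_degree E v)"
proof -
  have E: "\<And>x y. E x y \<Longrightarrow> x \<in> V \<and> y \<in> V \<and> x \<noteq> y \<and> E y x"
    using assms by (auto simp: finite_simple_graph_def)
  then show "is_clique V (square_adj E) (insert v {u. E v u})"
    using assms(2) unfolding is_clique_def square_adj_iff by blast
  have "finite {u. E v u}"
    using assms(1) E by (intro finite_subset[of "{u. E v u}" V]) (auto simp: finite_simple_graph_def)
  moreover have "\<not> E v v"
    using E by blast
  ultimately show "card (insert v {u. E v u}) = Suc (vertex_degree E v)"
    by (simp add: vertex_degree_def)
qed

theorem theorem4p5:
  fixes V :: "'a set" and E :: "'a \<Rightarrow> 'a \<Rightarrow> bool"
  assumes "finite_simple_graph V E"
    and "chordal E"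
    and "outerplanar V E"
    and "max_degree V E = 4"
  shows "(has_subgraph V E F4_verts F4_adj \<longrightarrow>
            clique_number V (square_adj E) = 6 \<and>
            chromatic_number V (square_adj E) = 6 \<and>
            inductiveness V (square_adj E) + 1 = 6) \<and>
         (\<not> has_subgraph V E F4_verts F4_adj \<longrightarrow>
            clique_number V (square_adj E) = 5 \<and>
            chromatic_number V (square_adj E) = 5 \<and>
            inductiveness V (square_adj E) + 1 = 5)"
proof -
  have fin: "finite V" and E: "\<And>x y. E x y \<Longrightarrow> x \<in> V \<and> y \<in> V \<and> x \<noteq> y \<and> E y x"
    using assms(1) by (auto simp: finite_simple_graph_def)
  obtain p \<gamma> where "plane_drawing V E p \<gamma>" "p ` V \<subseteq> frontier (outside (drawing_image V E p \<gamma>))"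
    using assms(3) by (auto simp: outerplanar_def)
  then interpret outerplane_graph V E p \<gamma>
    using assms(1) by unfold_locales
  \<comment> \<open>The supremum over the empty set is \<open>0\<close>, not
    \<open>4\<close>.\<close>
  have "V \<noteq> {}"
    using assms(4) by (auto simp: max_degree_def)
  then have max: "Max (vertex_degree E ` V) = 4"
    using assms(4) fin by (simp add: max_degree_def cSup_eq_Max)
  then obtain v where v: "v \<in> V" "vertex_degree E v = 4"
    using Max_in[of "vertex_degree E ` V"] fin \<open>V \<noteq> {}\<close> by auto
  have deg: "card {u. E x u} \<le> 4" for x
  proof (cases "x \<in> V")
    case True
    then show ?thesis
      using Max_ge[of "vertex_degree E ` V" "vertex_degree E x"] fin
      unfolding max by (simp add: vertex_degree_def)
  next
    case False
    then have "{u. E x u} = {}"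
      using E by blast
    then show ?thesis
      by simp
  qed
  have G: "sparse_chordal_graph V E"
  proof
    show False if "E a b" "E a x" "E b x" "E a y" "E b y" "E x y" for a b x y
      using no_K4[of a b x y] that E by blast
    \<comment> \<open>An edge in three triangles gives three paths of length two between its
      ends.\<close>
    show False if "E a b" "E a x" "E b x" "E a y" "E b y" "E a z" "E b z" "x \<noteq> y" "x \<noteq> z" "y \<noteq> z"
      for a b x y z
      using no_K23[of a b x y z] that E by blast
  qed (use assms deg in auto)
  have sym: "\<And>x y. square_adj E x y \<Longrightarrow> square_adj E y x"
    using E unfolding square_adj_iff by blast
  have irrefl: "\<And>x. \<not> square_adj E x x"
    by (simp add: square_adj_def)
  \<comment> \<open>Here \<open>k\<close> stays open: it becomes 5 if \<open>F4\<close> is present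
    and 4 otherwise.\<close>
  note tight = tight_degenerate_graph[OF fin sym irrefl square_degenerate[OF G]]
  show ?thesis
  proof (cases "has_subgraph V E F4_verts F4_adj")
    case True
    obtain K where "is_clique V (square_adj E) K" "card K = 6"
      using F4_square_clique[OF True] .
    then show ?thesis
      using tight[where k = 5] True by auto
  next
    case False
    then show ?thesis
      using tight[where k = 4] closed_neighbourhood_square_clique[OF assms(1) v(1)] v(2) by auto
  qed
qed

end
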